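(* Let $N\in\mathbb{N}$. There exists a $G$-function $\xi_N$ which is not an element of the field $\mathcal{K}_N$ of rational functions with coefficients in $\overline{\mathbb{C}(x)}$ of solutions of linear differential equations with coefficients in $\mathbb{C}(x)$ and at most $N$ singularities in $\mathbb{P}^1(\mathbb{C})$.
   Context: $\overline{\mathbb{Q}}\subset\mathbb{C}$ is the field of algebraic numbers. A $G$-function is a power series $F(x)=\sum_{n\ge0}a_nx^n\in\overline{\mathbb{Q}}[[x]]$ such that: (i) $F$ is a solution of a non-zero linear differential equation with coefficients in $\overline{\mathbb{Q}}(x)$; (ii) there is $C>0$ such that $|\sigma(a_n)|\le C^{n+1}$ for all $\sigma\in\mathrm{Gal}(\overline{\mathbb{Q}}/\mathbb{Q})$ and $n\ge0$; (iii) there are $D>0$ and integers $d_n$ with $1\le d_n\le D^{n+1}$ such that $d_na_m$ is an algebraic integer for all $m\le n$. Such a series has positive radius of convergence. Linear differential equations are homogeneous, $a_py^{(p)}+\dots+a_0y=0$ with $a_i\in\mathbb{C}[x]$ coprime and $a_p\neq0$, of arbitrary order $p$; the singularities in $\mathbb{C}$ are the zeros of $a_p$, and $\infty$ is a singularity if $t=0$ is one after the change of variable $x=1/t$. Elements of $\mathcal{K}_N$ are rational expressions, with coefficients that are algebraic functions over $\mathbb{C}(x)$, in finitely many solutions $f_1,\dots,f_k$, where $k$ and the differential equations (and their sets of at most $N$ singularities each) may vary with the solution. All functions are understood as meromorphic functions on some common nonempty connected open subset of $\mathbb{C}$; that a $G$-function $F$ belongs to $\mathcal{K}_N$ means that $F$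 (analytically continued) equals such a rational expression on some such open set. *)

theory Defs
  imports
    "HOL-Complex_Analysis.Complex_Analysis"
    "HOL-Computational_Algebra.Computational_Algebra"
    "HOL-Computational_Algebra.Field_as_Ring"
begin

section \<open>G-functions\<close>

text \<open>
  The library predicate \<^const>\<open>algebraic\<close> means algebraic over the rationals. Elements of the
  Galois group are represented by functions on all of the complex numbers, whose values outside
  the algebraic numbers are irrelevant.
\<close>

definition galois_Qbar :: "(complex \<Rightarrow> complex) set" where
  "galois_Qbar = {\<sigma>. bij_betw \<sigma> {z. algebraic z} {z. algebraic z} \<and>
     (\<forall>q\<in>\<rat>. \<sigma> q = q) \<and>
     (\<forall>x y. algebraic x \<longrightarrow> algebraic y \<longrightarrow>
        \<sigma> (x + y) = \<sigma> x + \<sigma> y \<and> \<sigma> (x * y) = \<sigma> x * \<sigma> y)}"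

text \<open>The field of rational functions over the algebraic numbers, inside the Laurent series.\<close>

definition Qbar_ratfuns :: "complex fls set" where
  "Qbar_ratfuns = {fps_to_fls (fps_of_poly p) / fps_to_fls (fps_of_poly q) | p q.
     q \<noteq> 0 \<and> (\<forall>i. algebraic (coeff p i)) \<and> (\<forall>i. algebraic (coeff q i))}"

definition G_function :: "complex fps \<Rightarrow> bool" where
  "G_function F \<longleftrightarrow>
     (\<forall>n. algebraic (fps_nth F n)) \<and>
     (\<exists>p c. (\<forall>i\<le>p. c i \<in> Qbar_ratfuns) \<and> (\<exists>i\<le>p. c i \<noteq> 0) \<and>
        (\<Sum>i\<le>p. c i * fps_to_fls (fps_nth_deriv i F)) = 0) \<and>
     (\<exists>C>0::real. \<forall>\<sigma>\<in>galois_Qbar. \<forall>n. norm (\<sigma> (fps_nth F n)) \<le> C ^ (n + 1)) \<and>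
     (\<exists>D>0::real. \<exists>d :: nat \<Rightarrow> int. \<forall>n. 1 \<le> d n \<and> real_of_int (d n) \<le> D ^ (n + 1) \<and>
        (\<forall>m\<le>n. algebraic_int (of_int (d n) * fps_nth F m)))"

section \<open>Linear differential equations and their singularities\<close>

text \<open>
  The equation with polynomial coefficients \<open>a\<^sub>0, \<dots>, a\<^sub>p\<close> (\<open>a\<^sub>p \<noteq> 0\<close>) is represented by
  \<open>L :: complex poly poly\<close> with \<open>coeff L i = a\<^sub>i\<close>; thus \<open>degree L\<close> is the order and
  \<open>lead_coeff L\<close> is the coefficient \<open>a\<^sub>p\<close>. This is only an encoding of the sequence of
  coefficients: the (commutative) product of \<^typ>\<open>complex poly poly\<close> is not the
  composition of operators. Coprimality of the coefficients is \<open>content L = 1\<close>.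
\<close>

definition lin_diff_eq :: "complex poly poly \<Rightarrow> bool" where
  "lin_diff_eq L \<longleftrightarrow> L \<noteq> 0 \<and> content L = 1"

text \<open>
  Under \<open>x = 1/t\<close> the derivation \<open>d/dx\<close> becomes \<open>-t\<^sup>2 d/dt\<close>. The following function composes the
  operator \<open>\<Sum>\<^sub>j c\<^sub>j (d/dt)\<^sup>j\<close> on the left with \<open>-t\<^sup>2 d/dt\<close>, which by the Leibniz rule gives
  \<open>-t\<^sup>2 \<Sum>\<^sub>j (c\<^sub>j' (d/dt)\<^sup>j + c\<^sub>j (d/dt)\<^sup>j\<^sup>+\<^sup>1)\<close>.
\<close>

definition deriv_wrt_inverse :: "complex poly poly \<Rightarrow> complex poly poly" where
  "deriv_wrt_inverse L = smult (- monom 1 2) (map_poly pderiv L + pCons 0 L)"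

text \<open>
  The equation obtained from \<open>L\<close> by \<open>x = 1/t\<close>: denominators are cleared by multiplying with
  \<open>t\<^sup>m\<close>, where \<open>m\<close> is the largest degree of a coefficient, so that \<open>a\<^sub>i(1/t)\<close> becomes
  \<open>t\<^sup>m\<^sup>-\<^sup>d\<close> times the reflected polynomial of \<open>a\<^sub>i\<close> with \<open>d\<close> the degree of \<open>a\<^sub>i\<close>; then the
  coefficients are made coprime by dividing by their gcd.
\<close>

definition eq_at_infinity :: "complex poly poly \<Rightarrow> complex poly poly" where
  "eq_at_infinity L =
     (let m = Max ((\<lambda>i. degree (coeff L i)) ` {..degree L})
      in primitive_part
           (\<Sum>i\<le>degree L. smult (monom 1 (m - degree (coeff L i)) * reflect_poly (coeff L i))
                                ((deriv_wrt_inverse ^^ i) 1)))"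

text \<open>In \<open>complex option\<close>, viewed as the projective line, \<open>None\<close> is the point at infinity.\<close>

definition singularities :: "complex poly poly \<Rightarrow> complex option set" where
  "singularities L =
     Some ` {z. poly (lead_coeff L) z = 0} \<union>
     (if poly (lead_coeff (eq_at_infinity L)) 0 = 0 then {None} else {})"

section \<open>The fields K\<close>

text \<open>
  Values of meromorphic functions at poles are arbitrary in the library, so identities
  between meromorphic functions on \<open>U\<close> are required outside a subset without accumulation point
  in \<open>U\<close>.
\<close>

definition solution_on :: "complex set \<Rightarrow> complex poly poly \<Rightarrow> (complex \<Rightarrow> complex) \<Rightarrow> bool" where
  "solution_on U L f \<longleftrightarrow> f meromorphic_on U \<and>
     (\<forall>\<^sub>\<approx>x\<in>U. (\<Sum>i\<le>degree L. poly (coeff L i) x * (deriv ^^ i) f x) = 0)"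

definition algebraic_function_on :: "complex set \<Rightarrow> (complex \<Rightarrow> complex) \<Rightarrow> bool" where
  "algebraic_function_on U a \<longleftrightarrow> a meromorphic_on U \<and>
     (\<exists>P :: complex poly poly. P \<noteq> 0 \<and>
        (\<forall>\<^sub>\<approx>x\<in>U. poly (map_poly (\<lambda>q. poly q x) P) (a x) = 0))"

text \<open>
  A polynomial in \<open>k\<close> functions \<open>f 0, \<dots>, f (k-1)\<close>, with finite set \<open>A\<close> of exponent vectors and
  with coefficient functions \<open>c\<close>.
\<close>

definition poly_expr ::
  "nat \<Rightarrow> (nat \<Rightarrow> nat) set \<Rightarrow> ((nat \<Rightarrow> nat) \<Rightarrow> complex \<Rightarrow> complex) \<Rightarrow>
   (nat \<Rightarrow> complex \<Rightarrow> complex) \<Rightarrow> complex \<Rightarrow> complex" where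
  "poly_expr k A c f x = (\<Sum>\<alpha>\<in>A. c \<alpha> x * (\<Prod>i<k. f i x ^ \<alpha> i))"

text \<open>The elements of the field \<open>K\<^sub>N\<close> that are defined on the domain \<open>U\<close>.\<close>

definition K_on :: "nat \<Rightarrow> complex set \<Rightarrow> (complex \<Rightarrow> complex) set" where
  "K_on N U = {h. h meromorphic_on U \<and>
     (\<exists>k f A c B d.
        (\<forall>i<k. \<exists>L. lin_diff_eq L \<and> card (singularities L) \<le> N \<and> solution_on U L (f i)) \<and>
        finite A \<and> (\<forall>\<alpha>\<in>A. algebraic_function_on U (c \<alpha>)) \<and>
        finite B \<and> (\<forall>\<beta>\<in>B. algebraic_function_on U (d \<beta>)) \<and>
        \<not> (\<forall>\<^sub>\<approx>x\<in>U. poly_expr k B d f x = 0) \<and>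
        (\<forall>\<^sub>\<approx>x\<in>U. h x = poly_expr k A c f x / poly_expr k B d f x))}"

text \<open>
  \<open>analytic_continuation F U g\<close>: the function \<open>g\<close> on the domain \<open>U\<close> is obtained from the sum of
  the power series \<open>F\<close> by analytic continuation along a finite chain of domains (so \<open>g\<close> may be
  any branch).
\<close>

inductive analytic_continuation :: "complex fps \<Rightarrow> complex set \<Rightarrow> (complex \<Rightarrow> complex) \<Rightarrow> bool"
  for F where
  start: "analytic_continuation F U g"
    if "open U" "connected U" "U \<noteq> {}" "U \<subseteq> eball 0 (fps_conv_radius F)"
      "\<And>z. z \<in> U \<Longrightarrow> g z = eval_fps F z"
| step: "analytic_continuation F V h"
    if "analytic_continuation F U g"
      "open V" "connected V" "h holomorphic_on V"
      "open W" "W \<noteq> {}" "W \<subseteq> U \<inter> V" "\<And>z. z \<in> W \<Longrightarrow> h z = g z"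

definition belongs_to_K :: "complex fps \<Rightarrow> nat \<Rightarrow> bool" where
  "belongs_to_K F N \<longleftrightarrow> (\<exists>U g. analytic_continuation F U g \<and> g \<in> K_on N U)"

end

theory Submission
  imports Defs "HOL-Algebra.Algebraic_Closure_Type"
begin

text \<open>
  The function is an iterated integral \<open>\<xi>\<close> of the forms \<open>dx / (x - s\<^sub>j)\<close> with \<open>N + 1\<close> distinct poles
  \<open>s\<^sub>j = 1/j\<close>. Let \<open>\<gamma>\<^sub>j\<close> be a loop around \<open>s\<^sub>j\<close> that encloses no other point of a finite set \<open>S\<close> containing
  all poles and all singularities of the equations in question. An equation with at most \<open>N\<close>
  singularities is regular at some \<open>s\<^sub>j\<close>, so \<open>\<gamma>\<^sub>j\<close>, and hence the iterated commutator \<open>w\<close> of all the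
  \<open>\<gamma>\<^sub>j\<close>, acts trivially on its solutions. On the other hand, the monodromy of \<open>\<xi>\<close> is unipotent, and
  \<open>w\<close> sends \<open>\<xi>\<close> to \<open>\<xi> + \<kappa>\<close> with a constant \<open>\<kappa> \<noteq> 0\<close>. If \<open>\<xi>\<close> were in \<open>K\<^sub>N\<close>, it would be algebraic
  over the field of functions fixed by \<open>w\<close>, whereas its conjugates \<open>\<xi> + m\<kappa>\<close> are infinitely many.

  The algebraic coefficients are never continued along \<open>w\<close>: only the fact that they are algebraic
  over the fixed field is used. The denominators of the coefficients of \<open>\<xi>\<close> divide powers of common
  multiples of \<open>1, \<dots>, n\<close>, which are bounded by means of central binomial coefficients.
\<close>

hide_const (open) Polynomials.degree Polynomials.lead_coeff up_ring.coeff up_ring.monom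
  Divisibility.prime module.smult

section \<open>Moving the centre of a power series\<close>

text \<open>No homotopy theory enters. A germ is a power series whose centre is kept outside it, a
  path is a finite chain of centres, and a loop is merely the operator that it induces on germs. The
  obstacle is that the pole at which an equation is regular varies with the equation, so no single
  loop around a pole fixes all solutions at once. A commutator is trivial as soon as one of its
  factors is, which makes one \<open>w\<close> serve for every solution, and \<open>N + 1\<close>
  poles are what the pigeonhole principle asks for. The construction gives \<kappa> = (2 pi
  i)^(N+1), one factor for each layer of integration.

  The poles are rational so that the coefficients are rational and conjugation does not affect the
  estimates; being reciprocals of integers, they leave the division by indices as the only source of
  denominators. Membership in the field allows any branch on any domain. The equation satisfied by
  the iterated integral survives continuation and is all that is used about the branch, so the
  argument can start at a generic point of that domain.\<close>

definition move :: "complex \<Rightarrow> complex \<Rightarrow> complex fps \<Rightarrow> complex fps" where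
  "move z u F = fps_expansion (\<lambda>x. eval_fps F (x - z)) u"

lemma move_has_fps_expansion:
  assumes "ereal (dist z u) < fps_conv_radius F"
  shows "(\<lambda>x. eval_fps F (u + x - z)) has_fps_expansion move z u F"
  unfolding move_def
  by (rule analytic_at_imp_has_fps_expansion)
     (use assms in \<open>auto intro!: analytic_intros simp: dist_norm norm_minus_commute\<close>)

lemma move_eqI:
  assumes "ereal (dist z u) < fps_conv_radius F" "f has_fps_expansion G"
    and "eventually (\<lambda>x. eval_fps F (u + x - z) = f x) (nhds 0)"
  shows "move z u F = G"
  using move_has_fps_expansion[OF assms(1)] assms(2) has_fps_expansion_cong[OF assms(3) refl, of "move z u F"]
  by (meson fps_expansion_unique_complex)

lemma eventually_translate_eball:
  assumes "ereal (dist z u) < r"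
  shows "eventually (\<lambda>x. ereal (norm (u + x - z)) < r) (nhds (0::complex))"
proof -
  have "open ((\<lambda>x. u + x - z) -` eball 0 r)"
    by (intro open_vimage continuous_intros) auto
  moreover have "0 \<in> (\<lambda>x. u + x - z) -` eball 0 r"
    using assms by (simp add: in_eball_iff dist_norm norm_minus_commute)
  ultimately have "eventually (\<lambda>x. x \<in> (\<lambda>x. u + x - z) -` eball 0 r) (nhds 0)"
    by (rule eventually_nhds_in_open)
  then show ?thesis by (simp add: in_eball_iff)
qed

lemma move_add:
  assumes "ereal (dist z u) < fps_conv_radius F" "ereal (dist z u) < fps_conv_radius G"
  shows "move z u (F + G) = move z u F + move z u G"
proof (rule move_eqI)
  show "ereal (dist z u) < fps_conv_radius (F + G)"
    using assms fps_conv_radius_add[of F G] by (meson less_le_trans min_less_iff_conj)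
  show "(\<lambda>x. eval_fps F (u + x - z) + eval_fps G (u + x - z)) has_fps_expansion move z u F + move z u G"
    by (intro has_fps_expansion_add move_has_fps_expansion assms)
  show "eventually (\<lambda>x. eval_fps (F + G) (u + x - z) = eval_fps F (u + x - z) + eval_fps G (u + x - z)) (nhds 0)"
    using eventually_translate_eball[OF assms(1)] eventually_translate_eball[OF assms(2)]
    by eventually_elim (rule eval_fps_add)
qed

lemma move_mult:
  assumes "ereal (dist z u) < fps_conv_radius F" "ereal (dist z u) < fps_conv_radius G"
  shows "move z u (F * G) = move z u F * move z u G"
proof (rule move_eqI)
  show "ereal (dist z u) < fps_conv_radius (F * G)"
    using assms fps_conv_radius_mult[of F G] by (meson less_le_trans min_less_iff_conj)
  show "(\<lambda>x. eval_fps F (u + x - z) * eval_fps G (u + x - z)) has_fps_expansion move z u F * move z u G"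
    by (intro has_fps_expansion_mult move_has_fps_expansion assms)
  show "eventually (\<lambda>x. eval_fps (F * G) (u + x - z) = eval_fps F (u + x - z) * eval_fps G (u + x - z)) (nhds 0)"
    using eventually_translate_eball[OF assms(1)] eventually_translate_eball[OF assms(2)]
    by eventually_elim (rule eval_fps_mult)
qed

lemma move_deriv:
  assumes "ereal (dist z u) < fps_conv_radius F"
  shows "move z u (fps_deriv F) = fps_deriv (move z u F)"
proof (rule move_eqI)
  show "ereal (dist z u) < fps_conv_radius (fps_deriv F)"
    using assms fps_conv_radius_deriv[of F] by (rule less_le_trans)
  show "deriv (\<lambda>x. eval_fps F (u + x - z)) has_fps_expansion fps_deriv (move z u F)"
    by (intro has_fps_expansion_deriv move_has_fps_expansion assms)
  show "eventually (\<lambda>x. eval_fps (fps_deriv F) (u + x - z) = deriv (\<lambda>x. eval_fps F (u + x - z)) x) (nhds 0)"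
    using eventually_translate_eball[OF assms]
  proof eventually_elim
    case (elim x)
    have "((\<lambda>x. eval_fps F (u + x - z)) has_field_derivative eval_fps (fps_deriv F) (u + x - z)) (at x)"
      using elim by (auto intro!: derivative_eq_intros simp: in_eball_iff)
    then show ?case by (simp add: DERIV_imp_deriv)
  qed
qed

lemma move_const [simp]: "move z u (fps_const c) = fps_const c"
  by (rule move_eqI[of _ _ _ "\<lambda>_. c"]) auto

section \<open>Polynomials as germs at an arbitrary centre\<close>

definition poly_germ :: "complex \<Rightarrow> complex poly \<Rightarrow> complex fps" where
  "poly_germ z p = fps_of_poly (pcompose p [:z, 1:])"

lemma eval_poly_germ [simp]: "eval_fps (poly_germ z p) x = poly p (z + x)"
  by (simp add: poly_germ_def poly_pcompose)

lemma fps_conv_radius_poly_germ [simp]: "fps_conv_radius (poly_germ z p) = \<infinity>"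
  by (simp add: poly_germ_def)

lemma poly_germ_has_fps_expansion: "(\<lambda>x. poly p (z + x)) has_fps_expansion poly_germ z p"
proof -
  have "eval_fps (poly_germ z p) = (\<lambda>x. poly p (z + x))" by (rule ext) simp
  then show ?thesis using eval_fps_has_fps_expansion[of "poly_germ z p"] by simp
qed

lemma move_poly_germ [simp]: "move z u (poly_germ z p) = poly_germ u p"
  by (rule move_eqI[of _ _ _ "\<lambda>x. poly p (u + x)"]) (auto intro: poly_germ_has_fps_expansion)

lemma poly_germ_eq_0_iff [simp]: "poly_germ z p = 0 \<longleftrightarrow> p = 0"
  by (simp add: poly_germ_def pcompose_eq_0_iff)

lemma poly_germ_nth_0 [simp]: "fps_nth (poly_germ z p) 0 = poly p z"
  using eval_poly_germ[of z p 0] by (simp add: eval_fps_at_0)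

lemma convex_eball: "convex (eball (z::complex) r)"
  by (cases r) auto

text \<open>Identity theorem on the intersection \<open>Q\<close> of the two discs of convergence,
  written in the coordinate at \<open>u\<close>. Discs are convex, so \<open>Q\<close> is connected,
  and it contains the new centre 0, near which both sides agree.\<close>

lemma eval_fps_move:
  assumes "ereal (dist z u) < fps_conv_radius F" "ereal (norm x) < fps_conv_radius (move z u F)"
    and "ereal (norm (u + x - z)) < fps_conv_radius F"
  shows "eval_fps (move z u F) x = eval_fps F (u + x - z)"
proof -
  define Q where "Q = eball 0 (fps_conv_radius (move z u F)) \<inter> eball (z - u) (fps_conv_radius F)"
  have Q: "x \<in> Q \<longleftrightarrow> ereal (norm x) < fps_conv_radius (move z u F) \<and> ereal (norm (u + x - z)) < fps_conv_radius F" for x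
    by (auto simp: Q_def in_eball_iff dist_norm norm_minus_commute algebra_simps)
  have "eval_fps (move z u F) x - eval_fps F (u + x - z) = 0"
  proof (rule has_fps_expansion_0_analytic_continuation[where f = "\<lambda>x. eval_fps (move z u F) x - eval_fps F (u + x - z)"])
    have "(\<lambda>x. eval_fps (move z u F) x - eval_fps F (u + x - z)) has_fps_expansion move z u F - move z u F"
      using move_has_fps_expansion[OF assms(1)]
      by (intro has_fps_expansion_diff eval_fps_has_fps_expansion) (auto simp: has_fps_expansion_def)
    then show "(\<lambda>x. eval_fps (move z u F) x - eval_fps F (u + x - z)) has_fps_expansion 0" by simp
    show "(\<lambda>x. eval_fps (move z u F) x - eval_fps F (u + x - z)) holomorphic_on Q"
      by (intro analytic_imp_holomorphic analytic_intros) (auto simp: Q)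
    show "open Q" unfolding Q_def by auto
    show "connected Q" unfolding Q_def
      by (intro convex_connected convex_Int convex_eball)
    show "0 \<in> Q"
      using assms move_has_fps_expansion[OF assms(1)] by (auto simp: Q has_fps_expansion_def dist_norm norm_minus_commute zero_ereal_def)
    show "x \<in> Q" using assms by (simp add: Q)
  qed
  then show ?thesis by simp
qed

text \<open>This is the only homotopy invariance in the proof: it serves to undo a step and to
  contract a small polygon.\<close>

lemma move_move:
  assumes "ereal (dist z u) < fps_conv_radius F" "ereal (dist z v) < fps_conv_radius F"
    and "ereal (dist u v) < fps_conv_radius (move z u F)"
  shows "move u v (move z u F) = move z v F"
proof (rule move_eqI[OF assms(3) move_has_fps_expansion[OF assms(2)]])
  show "eventually (\<lambda>x. eval_fps (move z u F) (v + x - u) = eval_fps F (v + x - z)) (nhds 0)"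
    using eventually_translate_eball[OF assms(2)] eventually_translate_eball[OF assms(3)]
    by eventually_elim (subst eval_fps_move[OF assms(1)], auto simp: algebra_simps)
qed

lemma move_self [simp]: "fps_conv_radius F > 0 \<Longrightarrow> move z z F = F"
  by (rule move_eqI[of _ _ _ "eval_fps F"])
     (auto simp: eval_fps_has_fps_expansion simp flip: zero_ereal_def)

section \<open>Germs that continue analytically outside a set\<close>

text \<open>The condition is symmetric so that every step can be undone.\<close>

definition adjacent :: "complex set \<Rightarrow> complex \<Rightarrow> complex \<Rightarrow> bool" where
  "adjacent S z u \<longleftrightarrow> dist z u < infdist z S \<and> dist z u < infdist u S"

lemma adjacent_sym: "adjacent S z u \<Longrightarrow> adjacent S u z"
  by (auto simp: adjacent_def dist_commute)

text \<open>\<open>infdist\<close> to the empty set is 0, hence the condition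
  \<open>S' \<noteq> {}\<close>; for the same reason sets such as \<open>S - {s}\<close> are kept
  nonempty below.\<close>

lemma adjacent_mono: "adjacent S z u \<Longrightarrow> S' \<subseteq> S \<Longrightarrow> S' \<noteq> {} \<Longrightarrow> adjacent S' z u"
  unfolding adjacent_def using infdist_mono[of S' S] by (meson less_le_trans)

text \<open>The greatest fixed point expresses unlimited continuation along chains avoiding
  \<open>S\<close> without quantifying over paths. A closure property follows by coinduction once
  the operation commutes with \<open>move\<close> and keeps the radius at least the distance to
  \<open>S\<close>.\<close>

coinductive continuable :: "complex set \<Rightarrow> complex \<Rightarrow> complex fps \<Rightarrow> bool" for S where
  continuableI: "\<lbrakk>fps_conv_radius F \<ge> ereal (infdist z S);
    \<And>u. adjacent S z u \<Longrightarrow> continuable S u (move z u F)\<rbrakk> \<Longrightarrow> continuable S z F"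

lemma continuable_radius: "continuable S z F \<Longrightarrow> fps_conv_radius F \<ge> ereal (infdist z S)"
  by (auto elim: continuable.cases)

lemma continuable_move: "continuable S z F \<Longrightarrow> adjacent S z u \<Longrightarrow> continuable S u (move z u F)"
  by (auto elim: continuable.cases)

lemma adjacent_radius: "continuable S z F \<Longrightarrow> adjacent S z u \<Longrightarrow> ereal (dist z u) < fps_conv_radius F"
  using continuable_radius[of S z F] unfolding adjacent_def by (meson less_le_trans ereal_less_eq(3) less_ereal.simps(1))

lemma continuable_mono:
  assumes "continuable S' z F" "S' \<subseteq> S" "S' \<noteq> {}"
  shows "continuable S z F"
  using assms(1)
proof (coinduction arbitrary: z F)
  case continuable
  have "infdist z S \<le> infdist z S'" using assms by (intro infdist_mono)
  then show ?case
    using continuable_radius[OF continuable] continuable_move[OF continuable] adjacent_mono[OF _ assms(2,3)]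
    by (auto intro: order_trans[of "ereal (infdist z S)" "ereal (infdist z S')"])
qed

lemma continuable_add:
  assumes "continuable S z F" "continuable S z G"
  shows "continuable S z (F + G)"
  using assms
proof (coinduction arbitrary: z F G)
  case continuable
  have "fps_conv_radius (F + G) \<ge> ereal (infdist z S)"
    using continuable fps_conv_radius_add[of F G] by (meson continuable_radius min.boundedI order_trans)
  moreover have "move z u (F + G) = move z u F + move z u G" "continuable S u (move z u F)" "continuable S u (move z u G)"
    if "adjacent S z u" for u
    using continuable that by (auto intro: continuable_move move_add adjacent_radius)
  ultimately show ?case by blast
qed

lemma continuable_mult:
  assumes "continuable S z F" "continuable S z G"
  shows "continuable S z (F * G)"
  using assms
proof (coinduction arbitrary: z F G)
  case continuable
  have "fps_conv_radius (F * G) \<ge> ereal (infdist z S)"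
    using continuable fps_conv_radius_mult[of F G] by (meson continuable_radius min.boundedI order_trans)
  moreover have "move z u (F * G) = move z u F * move z u G" "continuable S u (move z u F)" "continuable S u (move z u G)"
    if "adjacent S z u" for u
    using continuable that by (auto intro: continuable_move move_mult adjacent_radius)
  ultimately show ?case by blast
qed

lemma continuable_poly_germ: "continuable S z (poly_germ z p)"
  by (coinduction arbitrary: z) auto

lemma continuable_const: "continuable S z (fps_const c)"
  by (coinduction arbitrary: z) auto

lemma continuable_diff:
  assumes "continuable S z F" "continuable S z G"
  shows "continuable S z (F - G)"
  using continuable_add[OF assms(1) continuable_mult[OF continuable_const[of S z "-1"] assms(2)]]
  by (simp flip: fps_const_neg)

lemma continuable_deriv:
  assumes "continuable S z F"
  shows "continuable S z (fps_deriv F)"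
  using assms
proof (coinduction arbitrary: z F)
  case continuable
  have "fps_conv_radius (fps_deriv F) \<ge> ereal (infdist z S)"
    using continuable fps_conv_radius_deriv[of F] by (meson continuable_radius order_trans)
  moreover have "move z u (fps_deriv F) = fps_deriv (move z u F)" "continuable S u (move z u F)"
    if "adjacent S z u" for u
    using continuable that by (auto intro: continuable_move move_deriv adjacent_radius)
  ultimately show ?case by blast
qed

text \<open>Integration must not lose radius. For n >= 1 the coefficients n a_n of x F' dominate the
  a_n, which gives the inequality opposite to \<open>fps_conv_radius_deriv\<close>.\<close>

lemma fps_conv_radius_deriv_eq:
  "fps_conv_radius (fps_deriv F) = fps_conv_radius (F :: complex fps)"
proof (rule antisym[OF _ fps_conv_radius_deriv])
  have "fps_conv_radius (fps_deriv F) = conv_radius (\<lambda>n. of_nat (Suc n) * fps_nth F (Suc n))"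
    by (simp add: fps_conv_radius_def)
  also have "\<dots> = conv_radius (\<lambda>n. of_nat n * fps_nth F n)"
    using conv_radius_shift[of "\<lambda>n. of_nat n * fps_nth F n" 1] by simp
  also have "\<dots> \<le> conv_radius (fps_nth F)"
  proof (rule conv_radius_geI_ex')
    fix r :: real assume r: "0 < r" "ereal r < conv_radius (\<lambda>n. of_nat n * fps_nth F n)"
    have "summable (\<lambda>n. norm (of_nat n * fps_nth F n * of_real r ^ n))"
      by (rule abs_summable_in_conv_radius) (use r in auto)
    then show "summable (\<lambda>n. fps_nth F n * of_real r ^ n)"
    proof (rule summable_comparison_test_ev[rotated])
      have "1 * norm (fps_nth F n * of_real r ^ n) \<le> real n * norm (fps_nth F n * of_real r ^ n)" if "n \<ge> 1" for n
        using that by (intro mult_right_mono) auto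
      then show "\<forall>\<^sub>F n in sequentially. norm (fps_nth F n * of_real r ^ n) \<le> norm (of_nat n * fps_nth F n * of_real r ^ n)"
        by (intro eventually_mono[OF eventually_ge_at_top[of "1::nat"]]) (auto simp: norm_mult mult.assoc)
    qed
  qed
  finally show "fps_conv_radius (fps_deriv F) \<le> fps_conv_radius F" by (simp add: fps_conv_radius_def)
qed

text \<open>The coinduction invariant speaks of the derivative only, so no constant of integration
  has to be followed.\<close>

lemma continuable_primitive:
  assumes "continuable S z (fps_deriv F)"
  shows "continuable S z F"
  using assms
proof (coinduction arbitrary: z F)
  case continuable
  have "fps_conv_radius F \<ge> ereal (infdist z S)"
    using continuable_radius[OF continuable] by (simp add: fps_conv_radius_deriv_eq)
  moreover have "continuable S u (fps_deriv (move z u F))" if "adjacent S z u" for u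
    using continuable_move[OF continuable that] adjacent_radius[OF continuable that]
    by (simp add: move_deriv fps_conv_radius_deriv_eq)
  ultimately show ?case by blast
qed

lemma fps_conv_radius_quotient_poly_germ:
  assumes "poly_germ z p * F = H" "fps_conv_radius H \<ge> r" "r > 0" "\<And>x. poly p x = 0 \<Longrightarrow> ereal (dist z x) \<ge> r"
  shows "fps_conv_radius F \<ge> r"
proof -
  have "poly p z \<noteq> 0" using assms(3) assms(4)[of z] by (auto simp flip: zero_ereal_def)
  have nz: "poly p (z + x) \<noteq> 0" if "ereal (norm x) < r" for x
    using assms(4)[of "z + x"] that by (auto simp: dist_norm)
  have H: "eval_fps H has_fps_expansion H"
    by (rule eval_fps_has_fps_expansion) (use assms in auto)
  have "(\<lambda>x. eval_fps H x * inverse (poly p (z + x))) has_fps_expansion H * inverse (poly_germ z p)"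
    by (intro has_fps_expansion_mult has_fps_expansion_inverse H poly_germ_has_fps_expansion)
       (use \<open>poly p z \<noteq> 0\<close> in auto)
  also have "H * inverse (poly_germ z p) = F"
    using assms(1) \<open>poly p z \<noteq> 0\<close> by (metis inverse_mult_eq_1 mult.assoc mult.commute mult.left_neutral poly_germ_nth_0)
  finally show ?thesis
  proof (rule holomorphic_on_imp_fps_conv_radius_ge)
    have "ereal (norm x) < fps_conv_radius H" if "x \<in> eball 0 r" for x
      using that assms(2) by (simp add: in_eball_iff order_less_le_trans)
    then show "(\<lambda>x. eval_fps H x * inverse (poly p (z + x))) holomorphic_on eball 0 r"
      using nz by (intro holomorphic_intros) (auto simp: in_eball_iff)
  qed
qed

lemma continuable_quotient_poly_germ:
  assumes "continuable S z H" "poly_germ z p * F = H" "\<And>x. poly p x = 0 \<Longrightarrow> x \<in> S" "infdist z S > 0"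
  shows "continuable S z F"
  using assms(1,2,4)
proof (coinduction arbitrary: z F H)
  case continuable
  have r: "fps_conv_radius F \<ge> ereal (infdist z S)"
    by (rule fps_conv_radius_quotient_poly_germ[OF continuable(2)])
       (use continuable continuable_radius assms(3) in \<open>auto intro!: infdist_le\<close>)
  have "continuable S u (move z u H) \<and> poly_germ u p * move z u F = move z u H \<and> infdist u S > 0"
    if "adjacent S z u" for u
  proof (intro conjI)
    show "continuable S u (move z u H)" using continuable that by (blast intro: continuable_move)
    have "ereal (dist z u) < fps_conv_radius F"
      using r that unfolding adjacent_def by (meson less_le_trans less_ereal.simps(1))
    then show "poly_germ u p * move z u F = move z u H"
      using move_mult[of z u "poly_germ z p" F] continuable(2) by simp
    show "infdist u S > 0" using that unfolding adjacent_def by (meson le_less_trans zero_le_dist)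
  qed
  then show ?case using r by blast
qed

text \<open>Recording a path by its operator turns concatenation into composition; a loop is
  \<open>continuation S z z T\<close>. The operator is controlled only on continuable germs, since
  \<open>move\<close> is meaningful only within the disc of convergence.\<close>

inductive continuation :: "complex set \<Rightarrow> complex \<Rightarrow> complex \<Rightarrow> (complex fps \<Rightarrow> complex fps) \<Rightarrow> bool" for S z where
  continuation_id: "continuation S z z (\<lambda>F. F)"
| continuation_step: "\<lbrakk>continuation S z u T; adjacent S u v\<rbrakk> \<Longrightarrow> continuation S z v (\<lambda>F. move u v (T F))"

lemma continuation_move: "adjacent S z u \<Longrightarrow> continuation S z u (move z u)"
  using continuation_step[OF continuation_id] by simp

lemma continuation_trans:
  assumes "continuation S u v R" "continuation S z u T"
  shows "continuation S z v (\<lambda>F. R (T F))"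
  using assms by (induction) (auto intro: continuation_step)

text \<open>Loops built for the full set \<open>S\<close> must also act on germs that continue
  outside a smaller set, and keep them so.\<close>

lemma continuation_mono:
  assumes "continuation S z u T" "S' \<subseteq> S" "S' \<noteq> {}"
  shows "continuation S' z u T"
  using assms(1) by induction (auto intro: continuation.intros adjacent_mono[OF _ assms(2,3)])

lemma continuation_continuable:
  assumes "continuation S z u T" "continuable S z F"
  shows "continuable S u (T F)"
  using assms by induction (auto intro: continuable_move)

lemma continuation_add:
  assumes "continuation S z u T" "continuable S z F" "continuable S z G"
  shows "T (F + G) = T F + T G"
  using assms by induction (auto intro!: move_add adjacent_radius intro: continuation_continuable)

lemma continuation_mult:
  assumes "continuation S z u T" "continuable S z F" "continuable S z G"
  shows "T (F * G) = T F * T G"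
  using assms by induction (auto intro!: move_mult adjacent_radius intro: continuation_continuable)

lemma continuation_deriv:
  assumes "continuation S z u T" "continuable S z F"
  shows "T (fps_deriv F) = fps_deriv (T F)"
  using assms by induction (auto intro!: move_deriv adjacent_radius intro: continuation_continuable)

lemma continuation_poly_germ:
  assumes "continuation S z u T"
  shows "T (poly_germ z p) = poly_germ u p"
  using assms by induction auto

lemma continuation_const:
  assumes "continuation S z u T"
  shows "T (fps_const c) = fps_const c"
  using assms by induction auto

lemma continuation_diff:
  assumes "continuation S z u T" "continuable S z F" "continuable S z G"
  shows "T (F - G) = T F - T G"
  using continuation_add[OF assms(1) continuable_diff[OF assms(2,3)] assms(3)] by (simp add: algebra_simps)

text \<open>Reverse the chain. Adjacency is symmetric, so each centre lies in the disc of the other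
  germ and \<open>move_move\<close> undoes the step.\<close>

lemma continuation_inverse:
  assumes "continuation S z u T"
  shows "\<exists>T'. continuation S u z T' \<and> (\<forall>F. continuable S z F \<longrightarrow> T' (T F) = F) \<and>
    (\<forall>G. continuable S u G \<longrightarrow> T (T' G) = G)"
  using assms
proof induction
  case continuation_id
  show ?case by (rule exI[of _ "\<lambda>F. F"]) (auto intro: continuation.intros)
next
  case step: (continuation_step u T v)
  then obtain T' where T': "continuation S u z T'" "\<And>F. continuable S z F \<Longrightarrow> T' (T F) = F"
    "\<And>G. continuable S u G \<Longrightarrow> T (T' G) = G" by blast
  have ret: "\<lbrakk>continuable S u F; adjacent S u v\<rbrakk> \<Longrightarrow> move v u (move u v F) = F" for F u v
  proof -
    assume that: "continuable S u F" "adjacent S u v"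
    have "0 \<le> dist u v" by simp
    also have "dist u v < infdist u S" using that by (simp add: adjacent_def)
    finally have "0 < fps_conv_radius F" using continuable_radius[OF that(1)]
      by (metis less_le_trans less_ereal.simps(1) zero_ereal_def)
    then show ?thesis
      using adjacent_radius[OF that] adjacent_radius[OF continuable_move[OF that] adjacent_sym[OF that(2)]]
      by (subst move_move) (auto simp flip: zero_ereal_def)
  qed
  show ?case
  proof (intro exI[of _ "\<lambda>F. T' (move v u F)"] conjI allI impI)
    show "continuation S v z (\<lambda>F. T' (move v u F))"
      by (rule continuation_trans[OF T'(1) continuation_move[OF adjacent_sym[OF step(2)]]])
    show "T' (move v u (move u v (T F))) = F" if F: "continuable S z F" for F
      by (subst ret[OF continuation_continuable[OF step(1) F] step(2)]) (rule T'(2)[OF F])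
    show "move u v (T (T' (move v u G))) = G" if G: "continuable S v G" for G
      by (subst T'(3)[OF continuable_move[OF G adjacent_sym[OF step(2)]]]) (rule ret[OF G adjacent_sym[OF step(2)]])
  qed
qed

lemma continuation_exists:
  assumes "finite S" "S \<noteq> {}" "z \<notin> S" "u \<notin> S"
  shows "\<exists>T. continuation S z u T"
proof (rule connected_induction_simple[of "-S" z u])
  show "connected (-S)" using assms(1)
    by (metis Compl_eq_Diff_UNIV DIM_complex connected_UNIV connected_open_diff_countable countable_finite open_UNIV order_refl)
  show "\<exists>T. continuation S z z T" by (blast intro: continuation_id)
  fix a assume "a \<in> - S"
  define d where "d = infdist a S"
  have "closed S" using assms(1) by (rule finite_imp_closed)
  then have d: "d > 0" unfolding d_def using \<open>a \<in> -S\<close> assms(2)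
    by (metis ComplD in_closed_iff_infdist_zero infdist_nonneg less_eq_real_def)
  \<comment> \<open>Two points of the disc of radius \<open>d/3\<close> are less than
    \<open>2 * d / 3\<close> apart and both farther than that from \<open>S\<close>, so any two of
    them are adjacent.\<close>
  have far: "infdist x S > 2 * d / 3" if "x \<in> ball a (d/3)" for x
    using infdist_triangle[of a S x] that by (auto simp: d_def)
  have adj: "adjacent S x y" if "x \<in> ball a (d/3)" "y \<in> ball a (d/3)" for x y
    using far[OF that(1)] far[OF that(2)] that dist_triangle2[of x y a] unfolding adjacent_def by (auto simp: dist_commute)
  show "\<exists>T. openin (top_of_set (- S)) T \<and> a \<in> T \<and> (\<forall>x\<in>T. \<forall>y\<in>T. (\<exists>T. continuation S z x T) \<longrightarrow> (\<exists>T. continuation S z y T))"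
  proof (intro exI[of _ "ball a (d/3)"] conjI ballI impI)
    have "ball a (d/3) \<subseteq> -S" using far d by force
    then show "openin (top_of_set (- S)) (ball a (d/3))" by (simp add: open_openin_trans openin_open_eq open_Compl \<open>closed S\<close>)
    show "a \<in> ball a (d/3)" using d by simp
    show "\<exists>T. continuation S z y T" if "x \<in> ball a (d/3)" "y \<in> ball a (d/3)" "\<exists>T. continuation S z x T" for x y
      using that adj by (blast intro: continuation_step)
  qed
qed (use assms in auto)

section \<open>Solutions of linear differential equations continue\<close>

lemma fps_nth_nth_deriv:
  "fps_nth (fps_nth_deriv i F) m = of_nat (pochhammer (Suc m) i) * fps_nth (F :: complex fps) (m + i)"
proof (induction i arbitrary: m)
  case (Suc i)
  show ?case
    by (simp add: fps_nth_deriv_commute Suc pochhammer_rec del: fps_nth_deriv.simps of_nat_Suc of_nat_add mult_Suc)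
qed simp

lemma pochhammer_nat_mono: "m \<le> n \<Longrightarrow> pochhammer (m::nat) i \<le> pochhammer n i"
  by (auto simp: pochhammer_prod intro!: prod_mono)

text \<open>The product of length \<open>p\<close> has the further factor \<open>Suc n + i\<close>,
  which is at least \<open>n + 1\<close>: this is the gain used in the coefficient bound.\<close>

lemma pochhammer_nat_step:
  assumes "i < p"
  shows "(n + 1) * pochhammer (Suc n) i \<le> pochhammer (Suc n) p"
proof -
  obtain q where p: "p = i + Suc q" using assms by (metis less_imp_Suc_add add_Suc_right)
  have "pochhammer (Suc n + i) (Suc q) = (Suc n + i) * pochhammer (Suc n + i + 1) q"
    by (rule pochhammer_rec)
  moreover have "pochhammer (Suc n + i + 1) q \<ge> 1"
    by (simp add: Suc_leI pochhammer_pos)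
  ultimately have "n + 1 \<le> pochhammer (Suc n + i) (Suc q)"
    by (metis Suc_eq_plus1 le_add1 mult.right_neutral mult_le_mono)
  moreover have "pochhammer (Suc n) p = pochhammer (Suc n) i * pochhammer (Suc n + i) (Suc q)"
    unfolding p by (subst pochhammer_product') simp
  ultimately show ?thesis by (metis mult.commute mult_le_mono2)
qed

text \<open>
  Multiplying the recursion for the coefficients of \<open>F\<close> by \<open>\<sigma>\<^sup>n\<close> and dividing by the leading
  factor gives a gain of \<open>1/(n+1)\<close>, because the order of derivation drops.
\<close>

lemma linear_ode_coeff_bound:
  fixes F :: "complex fps" and b :: "nat \<Rightarrow> complex fps"
  assumes ode: "fps_nth_deriv p F = (\<Sum>i<p. b i * fps_nth_deriv i F)"
    and b: "\<And>i k. i < p \<Longrightarrow> norm (fps_nth (b i) k) * \<rho> ^ k \<le> B"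
    and \<sigma>: "0 < \<sigma>" "\<sigma> < \<rho>"
  shows "\<exists>C. \<forall>n. norm (fps_nth F n) * \<sigma> ^ n \<le> C"
proof -
  define v where "v n = norm (fps_nth F n) * \<sigma> ^ n" for n
  \<comment> \<open>The geometric series in \<open>\<sigma> / \<rho>\<close> dominates the
    convolution with the coefficients of \<open>b i\<close>; \<open>\<sigma> ^ (p - i)\<close> pays
    for the drop in order from \<open>p\<close> to \<open>i\<close>.\<close>
  define K where "K = (\<Sum>i<p. \<bar>B\<bar> * \<sigma> ^ (p - i) * (1 / (1 - \<sigma> / \<rho>)))"
  have v0: "v n \<ge> 0" for n using \<sigma> by (simp add: v_def)
  have q: "0 \<le> \<sigma> / \<rho>" "\<sigma> / \<rho> < 1" using \<sigma> by auto
  have K0: "K \<ge> 0" unfolding K_def using \<sigma> q by (intro sum_nonneg mult_nonneg_nonneg) auto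
  have step: "v (n + p) \<le> M * K / (n + 1)" if M: "\<And>m. m < n + p \<Longrightarrow> v m \<le> M" "M \<ge> 0" for n M
  proof -
    define P where "P = real (pochhammer (Suc n) p)"
    have P: "P > 0" unfolding P_def by (simp add: pochhammer_pos)
    have summand: "norm (fps_nth (b i) k * (of_nat (pochhammer (Suc (n - k)) i) * fps_nth F (n - k + i))) * \<sigma> ^ (n + p)
        \<le> P / (n + 1) * M * (\<bar>B\<bar> * \<sigma> ^ (p - i) * (\<sigma> / \<rho>) ^ k)" if ik: "i < p" "k \<le> n" for i k
    proof -
      have 1: "norm (fps_nth (b i) k) \<le> \<bar>B\<bar> / \<rho> ^ k"
        using b[OF ik(1), of k] \<sigma> by (simp add: field_simps)
      have "real (n + 1) * real (pochhammer (Suc (n - k)) i) \<le> P"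
      proof -
        have "(n + 1) * pochhammer (Suc (n - k)) i \<le> (n + 1) * pochhammer (Suc n) i"
          by (intro mult_le_mono pochhammer_nat_mono) auto
        also have "\<dots> \<le> pochhammer (Suc n) p" by (rule pochhammer_nat_step[OF ik(1)])
        finally show ?thesis unfolding P_def by (metis of_nat_le_iff of_nat_mult)
      qed
      then have 2: "real (pochhammer (Suc (n - k)) i) \<le> P / (n + 1)"
        by (simp add: field_simps)
      have "v (n - k + i) \<le> M" using ik by (intro M) auto
      then have 3: "norm (fps_nth F (n - k + i)) * \<sigma> ^ (n - k + i) \<le> M" by (simp add: v_def)
      have e: "\<sigma> ^ (n + p) = \<sigma> ^ (n - k + i) * (\<sigma> ^ (p - i) * \<sigma> ^ k)"
        using ik by (simp flip: power_add)
      have "norm (fps_nth (b i) k * (of_nat (pochhammer (Suc (n - k)) i) * fps_nth F (n - k + i))) * \<sigma> ^ (n + p)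
          = norm (fps_nth (b i) k) * (real (pochhammer (Suc (n - k)) i) *
              ((norm (fps_nth F (n - k + i)) * \<sigma> ^ (n - k + i)) * (\<sigma> ^ (p - i) * \<sigma> ^ k)))"
        unfolding e norm_mult norm_of_nat by (simp only: mult_ac)
      also have "\<dots> \<le> \<bar>B\<bar> / \<rho> ^ k * (P / (n + 1) * (M * (\<sigma> ^ (p - i) * \<sigma> ^ k)))"
        using 1 2 3 \<sigma> P M(2) by (intro mult_mono mult_nonneg_nonneg) (auto intro: divide_nonneg_nonneg)
      also have "\<dots> = P / (n + 1) * M * (\<bar>B\<bar> * \<sigma> ^ (p - i) * (\<sigma> / \<rho>) ^ k)"
        by (simp add: power_divide mult_ac)
      finally show ?thesis .
    qed
    have geo: "(\<Sum>k\<le>n. (\<sigma> / \<rho>) ^ k) \<le> 1 / (1 - \<sigma> / \<rho>)"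
    proof -
      have "(\<Sum>k\<le>n. (\<sigma> / \<rho>) ^ k) \<le> suminf (\<lambda>k. (\<sigma> / \<rho>) ^ k)"
        using q by (intro sum_le_suminf summable_geometric) auto
      also have "\<dots> = 1 / (1 - \<sigma> / \<rho>)" using q by (intro suminf_geometric) auto
      finally show ?thesis .
    qed
    have "of_nat (pochhammer (Suc n) p) * fps_nth F (n + p) = fps_nth (fps_nth_deriv p F) n"
      by (simp only: fps_nth_nth_deriv)
    also have "\<dots> = (\<Sum>i<p. \<Sum>k\<le>n. fps_nth (b i) k * (of_nat (pochhammer (Suc (n - k)) i) * fps_nth F (n - k + i)))"
      unfolding ode fps_sum_nth fps_mult_nth fps_nth_nth_deriv atLeast0AtMost ..
    finally have "P * v (n + p) = norm (\<Sum>i<p. \<Sum>k\<le>n. fps_nth (b i) k *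
        (of_nat (pochhammer (Suc (n - k)) i) * fps_nth F (n - k + i))) * \<sigma> ^ (n + p)"
      unfolding P_def v_def by (metis mult.assoc norm_mult norm_of_nat)
    also have "\<dots> \<le> (\<Sum>i<p. \<Sum>k\<le>n. norm (fps_nth (b i) k *
        (of_nat (pochhammer (Suc (n - k)) i) * fps_nth F (n - k + i)))) * \<sigma> ^ (n + p)"
      using \<sigma> by (intro mult_right_mono order_trans[OF norm_sum] sum_mono norm_sum) auto
    also have "\<dots> = (\<Sum>i<p. \<Sum>k\<le>n. norm (fps_nth (b i) k *
        (of_nat (pochhammer (Suc (n - k)) i) * fps_nth F (n - k + i))) * \<sigma> ^ (n + p))"
      by (simp only: sum_distrib_right)
    also have "\<dots> \<le> (\<Sum>i<p. \<Sum>k\<le>n. P / (n + 1) * M * (\<bar>B\<bar> * \<sigma> ^ (p - i) * (\<sigma> / \<rho>) ^ k))"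
      by (intro sum_mono summand) auto
    also have "\<dots> = (\<Sum>i<p. P / (n + 1) * M * (\<bar>B\<bar> * \<sigma> ^ (p - i) * (\<Sum>k\<le>n. (\<sigma> / \<rho>) ^ k)))"
      by (simp only: sum_distrib_left)
    also have "\<dots> \<le> (\<Sum>i<p. P / (n + 1) * M * (\<bar>B\<bar> * \<sigma> ^ (p - i) * (1 / (1 - \<sigma> / \<rho>))))"
      using geo P M(2) \<sigma> by (intro sum_mono mult_left_mono mult_nonneg_nonneg) auto
    also have "\<dots> = P * (M * K / (n + 1))"
      by (simp add: K_def sum_distrib_left sum_divide_distrib mult_ac)
    finally show ?thesis using P by (simp only: mult_le_cancel_left_pos)
  qed
  \<comment> \<open>For \<open>n \<ge> n0\<close> the factor \<open>K / (n + 1)\<close> is at most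
    1, so a bound on the earlier values propagates; \<open>M\<close> bounds the initial
    ones.\<close>
  obtain n0 where n0: "K \<le> real n0" using real_arch_simple by blast
  define M where "M = (\<Sum>m<n0 + p. v m)"
  have M0: "M \<ge> 0" unfolding M_def by (intro sum_nonneg v0)
  have "v m \<le> M" for m
  proof (induction m rule: less_induct)
    case (less m)
    show ?case
    proof (cases "m < n0 + p")
      case True
      then show ?thesis unfolding M_def by (intro member_le_sum v0) auto
    next
      case False
      define n where "n = m - p"
      have n: "m = n + p" "n0 \<le> n" using False by (auto simp: n_def)
      have "v m \<le> M * K / (n + 1)" unfolding n by (rule step) (use less M0 n in auto)
      also have "\<dots> = M * (K / (n + 1))" by simp
      also have "K / (n + 1) \<le> 1" using n n0 by simp
      then have "M * (K / (n + 1)) \<le> M * 1" by (rule mult_left_mono) (rule M0)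
      finally show ?thesis by simp
    qed
  qed
  then show ?thesis unfolding v_def by blast
qed

lemma linear_ode_conv_radius:
  fixes F :: "complex fps" and b :: "nat \<Rightarrow> complex fps"
  assumes ode: "fps_nth_deriv p F = (\<Sum>i<p. b i * fps_nth_deriv i F)"
    and b: "\<And>i. i < p \<Longrightarrow> fps_conv_radius (b i) \<ge> R"
  shows "fps_conv_radius F \<ge> R"
  unfolding fps_conv_radius_def
proof (rule conv_radius_geI_ex')
  fix r :: real assume r: "0 < r" "ereal r < R"
  \<comment> \<open>Three radii are needed: the coefficient bounds hold at \<rho>, the bound on
    \<open>F\<close> at \<sigma> < \<rho>, and summability at r < \<sigma>.\<close>
  obtain \<rho> where \<rho>: "r < \<rho>" "ereal \<rho> < R" using r ereal_dense2 less_ereal.simps(1) by blast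
  define \<sigma> where "\<sigma> = (r + \<rho>) / 2"
  have \<sigma>: "r < \<sigma>" "\<sigma> < \<rho>" using \<rho> by (auto simp: \<sigma>_def)
  have "\<exists>B. \<forall>k. norm (fps_nth (b i) k) * \<rho> ^ k \<le> B" if "i < p" for i
  proof -
    have "ereal \<rho> < conv_radius (fps_nth (b i))" using b[OF that] \<rho> unfolding fps_conv_radius_def by order
    then have "summable (\<lambda>k. norm (fps_nth (b i) k * of_real \<rho> ^ k))"
      by (intro abs_summable_in_conv_radius) (use \<rho> r in auto)
    then have "Bseq (\<lambda>k. norm (fps_nth (b i) k * of_real \<rho> ^ k))"
      by (intro convergent_imp_Bseq convergentI[OF summable_LIMSEQ_zero])
    then show ?thesis using \<rho> r by (auto simp: Bseq_def norm_mult norm_power)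
  qed
  then obtain B where B: "\<And>i k. i < p \<Longrightarrow> norm (fps_nth (b i) k) * \<rho> ^ k \<le> B i" by metis
  have "norm (fps_nth (b i) k) * \<rho> ^ k \<le> Max (insert 0 (B ` {..<p}))" if "i < p" for i k
    using B[OF that, of k] that by (meson Max_ge finite.insertI finite_imageI finite_lessThan imageI insertI2 lessThan_iff order_trans)
  from linear_ode_coeff_bound[OF ode this, of \<sigma>]
  obtain C where C: "\<And>n. norm (fps_nth F n) * \<sigma> ^ n \<le> C" using \<sigma> r by auto
  show "summable (\<lambda>n. fps_nth F n * of_real r ^ n)"
  proof (rule summable_comparison_test_ev)
    show "summable (\<lambda>n. C * (r / \<sigma>) ^ n)"
      using \<sigma> r by (intro summable_mult summable_geometric) auto
    have "norm (fps_nth F n * of_real r ^ n) \<le> C * (r / \<sigma>) ^ n" for n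
    proof -
      have "norm (fps_nth F n * of_real r ^ n) = norm (fps_nth F n) * \<sigma> ^ n * (r / \<sigma>) ^ n"
        using \<sigma> r by (simp add: norm_mult norm_power power_divide)
      also have "\<dots> \<le> C * (r / \<sigma>) ^ n" using C \<sigma> r by (intro mult_right_mono) auto
      finally show ?thesis .
    qed
    then show "\<forall>\<^sub>F n in sequentially. norm (fps_nth F n * of_real r ^ n) \<le> C * (r / \<sigma>) ^ n" by simp
  qed
qed

definition formal_solution :: "complex \<Rightarrow> complex poly poly \<Rightarrow> complex fps \<Rightarrow> bool" where
  "formal_solution z L F \<longleftrightarrow> (\<Sum>i\<le>degree L. poly_germ z (coeff L i) * fps_nth_deriv i F) = 0"

lemma formal_solution_conv_radius:
  assumes "formal_solution z L F" "L \<noteq> 0" "infdist z S > 0" "\<And>x. poly (lead_coeff L) x = 0 \<Longrightarrow> x \<in> S"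
  shows "fps_conv_radius F \<ge> ereal (infdist z S)"
proof (rule linear_ode_conv_radius)
  define p where "p = degree L"
  define a where "a i = poly_germ z (coeff L i)" for i
  define b where "b i = - inverse (a p) * a i" for i
  have ap0: "fps_nth (a p) 0 \<noteq> 0" using assms(3,4) by (auto simp: a_def p_def)
  have inv: "a p * inverse (a p) = 1" using ap0 by (metis inverse_mult_eq_1 mult.commute)
  have "(\<Sum>i<p. a i * fps_nth_deriv i F) + a p * fps_nth_deriv p F = 0"
    using assms(1) unfolding formal_solution_def p_def a_def by (simp add: lessThan_Suc_atMost[symmetric])
  then have *: "a p * fps_nth_deriv p F = - (\<Sum>i<p. a i * fps_nth_deriv i F)" by (simp add: eq_neg_iff_add_eq_0 add.commute)
  have "fps_nth_deriv p F = inverse (a p) * (a p * fps_nth_deriv p F)"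
    using inv by (metis mult.assoc mult.commute mult.left_neutral)
  also have "\<dots> = (\<Sum>i<p. b i * fps_nth_deriv i F)"
    unfolding * b_def by (simp add: sum_distrib_left sum_negf mult.assoc)
  finally show "fps_nth_deriv p F = (\<Sum>i<p. b i * fps_nth_deriv i F)" .
  show "ereal (infdist z S) \<le> fps_conv_radius (b i)" for i
  proof (rule fps_conv_radius_quotient_poly_germ)
    show "poly_germ z (lead_coeff L) * b i = - a i"
      unfolding b_def using inv unfolding p_def a_def by (simp add: mult.assoc[symmetric])
    show "ereal (infdist z S) \<le> fps_conv_radius (- a i)" by (simp add: a_def)
    show "ereal (infdist z S) \<le> ereal (dist z x)" if "poly (lead_coeff L) x = 0" for x
      using assms(4)[OF that] by (simp add: infdist_le)
  qed (use assms in auto)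
qed

lemma fps_conv_radius_nth_deriv_eq: "fps_conv_radius (fps_nth_deriv i F) = fps_conv_radius (F :: complex fps)"
  by (induction i arbitrary: F) (auto simp: fps_conv_radius_deriv_eq)

lemma move_nth_deriv:
  "ereal (dist z u) < fps_conv_radius F \<Longrightarrow> move z u (fps_nth_deriv i F) = fps_nth_deriv i (move z u F)"
  by (induction i arbitrary: F) (auto simp: move_deriv fps_conv_radius_deriv_eq)

text \<open>The radius belongs to the conclusion because the next addition in the induction needs
  it.\<close>

lemma move_sum:
  assumes "finite A" "\<And>i. i \<in> A \<Longrightarrow> ereal (dist z u) < fps_conv_radius (f i)"
  shows "move z u (sum f A) = (\<Sum>i\<in>A. move z u (f i)) \<and> ereal (dist z u) < fps_conv_radius (sum f A)"
  using assms
proof (induction A rule: finite_induct)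
  case empty
  show ?case using move_const[of z u 0] by simp
next
  case (insert i A)
  then have 1: "ereal (dist z u) < fps_conv_radius (f i)"
    and 2: "move z u (sum f A) = (\<Sum>i\<in>A. move z u (f i))" "ereal (dist z u) < fps_conv_radius (sum f A)" by auto
  have "ereal (dist z u) < fps_conv_radius (f i + sum f A)"
    using 1 2(2) fps_conv_radius_add[of "f i" "sum f A"] by (meson less_le_trans min_less_iff_conj)
  then show ?case using insert(1,2) 1 2 by (simp add: move_add)
qed

lemma formal_solution_move:
  assumes "formal_solution z L F" "ereal (dist z u) < fps_conv_radius F"
  shows "formal_solution u L (move z u F)"
proof -
  have r: "ereal (dist z u) < fps_conv_radius (poly_germ z (coeff L i) * fps_nth_deriv i F)" for i
    using assms(2) fps_conv_radius_mult[of "poly_germ z (coeff L i)" "fps_nth_deriv i F"]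
    by (simp add: fps_conv_radius_nth_deriv_eq)
  have "0 = move z u (\<Sum>i\<le>degree L. poly_germ z (coeff L i) * fps_nth_deriv i F)"
    using assms(1) move_const[of z u 0] unfolding formal_solution_def by simp
  also have "\<dots> = (\<Sum>i\<le>degree L. move z u (poly_germ z (coeff L i) * fps_nth_deriv i F))"
    using move_sum[of "{..degree L}" z u "\<lambda>i. poly_germ z (coeff L i) * fps_nth_deriv i F"] r by auto
  also have "\<dots> = (\<Sum>i\<le>degree L. poly_germ u (coeff L i) * fps_nth_deriv i (move z u F))"
    using assms(2) by (intro sum.cong refl) (simp add: move_mult move_nth_deriv fps_conv_radius_nth_deriv_eq)
  finally show ?thesis unfolding formal_solution_def by simp
qed

text \<open>The property of being a formal solution forces the radius and is preserved by every move
  within it, so it is itself the coinduction invariant.\<close>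

lemma formal_solution_continuable:
  assumes "formal_solution z L F" "L \<noteq> 0" "infdist z S > 0" "\<And>x. poly (lead_coeff L) x = 0 \<Longrightarrow> x \<in> S"
  shows "continuable S z F"
  using assms(1,3)
proof (coinduction arbitrary: z F)
  case continuable
  have r: "fps_conv_radius F \<ge> ereal (infdist z S)"
    using formal_solution_conv_radius[OF continuable(1) assms(2) continuable(2) assms(4)] .
  have "formal_solution u L (move z u F) \<and> infdist u S > 0" if "adjacent S z u" for u
  proof
    have "ereal (dist z u) < fps_conv_radius F"
      using r that unfolding adjacent_def by (meson less_le_trans less_ereal.simps(1))
    with continuable(1) show "formal_solution u L (move z u F)" by (rule formal_solution_move)
    show "infdist u S > 0" using that unfolding adjacent_def by (meson le_less_trans zero_le_dist)
  qed
  then show ?case using r by blast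
qed

section \<open>Loops around a point\<close>

text \<open>Vertices of a regular octagon. Neighbours are at distance \<delta> sqrt(2 - sqrt 2) <
  \<delta>; for a hexagon it would be exactly \<delta>, too much for the strict inequalities in
  \<open>adjacent\<close>.\<close>

definition circle_pt :: "complex \<Rightarrow> real \<Rightarrow> nat \<Rightarrow> complex" where
  "circle_pt s \<delta> k = s + of_real \<delta> * cis (pi / 4) ^ k"

lemma circle_pt_0 [simp]: "circle_pt s \<delta> 0 = s + of_real \<delta>"
  by (simp add: circle_pt_def)

lemma circle_pt_8 [simp]: "circle_pt s \<delta> 8 = s + of_real \<delta>"
  by (simp add: circle_pt_def Complex.DeMoivre)

lemma dist_circle_pt: "\<delta> > 0 \<Longrightarrow> dist (circle_pt s \<delta> k) s = \<delta>"
  by (simp add: circle_pt_def dist_norm norm_mult norm_power)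

lemma dist_circle_pt_Suc:
  assumes "\<delta> > 0"
  shows "dist (circle_pt s \<delta> k) (circle_pt s \<delta> (Suc k)) < \<delta>"
proof -
  have "(norm (1 - cis (pi / 4)))\<^sup>2 = 2 - sqrt 2"
    by (simp add: cmod_power2 cos_45 sin_45 power2_diff power_divide)
  also have "\<dots> < 1\<^sup>2" by simp
  finally have "norm (1 - cis (pi / 4)) < 1" by (rule power2_less_imp_less) simp
  moreover have "circle_pt s \<delta> k - circle_pt s \<delta> (Suc k) = of_real \<delta> * cis (pi / 4) ^ k * (1 - cis (pi / 4))"
    by (simp add: circle_pt_def algebra_simps)
  ultimately show ?thesis
    using assms by (simp add: dist_norm norm_mult norm_power)
qed

text \<open>The factor 4 keeps the circle of radius \<delta> at distance 3 \<delta> from the rest of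
  \<open>S\<close>. As its diameter is only 2 \<delta>, a germ that is regular at \<open>s\<close>
  converges on a disc containing all vertices.\<close>

locale isolated_point =
  fixes S :: "complex set" and s :: complex and \<delta> :: real
  assumes s_in: "s \<in> S" and \<delta>_pos: "\<delta> > 0" and isolated: "\<And>x. x \<in> S \<Longrightarrow> x \<noteq> s \<Longrightarrow> dist s x \<ge> 4 * \<delta>"
begin

lemma infdist_circle_pt: "infdist (circle_pt s \<delta> k) S \<ge> \<delta>"
proof -
  have "\<delta> \<le> dist (circle_pt s \<delta> k) x" if "x \<in> S" for x
    using isolated[OF that] dist_circle_pt[OF \<delta>_pos, of s k] dist_triangle[of s x "circle_pt s \<delta> k"] \<delta>_pos
    by (cases "x = s") (auto simp: dist_commute)
  then show ?thesis using s_in by (auto simp: infdist_def intro!: cINF_greatest)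
qed

lemma infdist_circle_pt_Diff: "S - {s} \<noteq> {} \<Longrightarrow> infdist (circle_pt s \<delta> k) (S - {s}) \<ge> 3 * \<delta>"
proof -
  assume ne: "S - {s} \<noteq> {}"
  have "3 * \<delta> \<le> dist (circle_pt s \<delta> k) x" if "x \<in> S - {s}" for x
    using isolated[of x] dist_circle_pt[OF \<delta>_pos, of s k] dist_triangle[of s x "circle_pt s \<delta> k"] that
    by (auto simp: dist_commute)
  then show ?thesis using ne by (auto simp: infdist_def intro!: cINF_greatest)
qed

lemma adjacent_circle_pt: "adjacent S (circle_pt s \<delta> k) (circle_pt s \<delta> (Suc k))"
  using dist_circle_pt_Suc[OF \<delta>_pos, of s k] infdist_circle_pt[of k] infdist_circle_pt[of "Suc k"]
  unfolding adjacent_def by linarith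

primrec circ :: "nat \<Rightarrow> complex fps \<Rightarrow> complex fps" where
  "circ 0 F = F"
| "circ (Suc k) F = move (circle_pt s \<delta> k) (circle_pt s \<delta> (Suc k)) (circ k F)"

lemma continuation_circ: "continuation S (circle_pt s \<delta> 0) (circle_pt s \<delta> k) (circ k)"
proof (induction k)
  case 0
  have "circ 0 = (\<lambda>F. F)" by (rule ext) simp
  then show ?case by (simp only: continuation_id)
next
  case (Suc k)
  have "circ (Suc k) = (\<lambda>F. move (circle_pt s \<delta> k) (circle_pt s \<delta> (Suc k)) (circ k F))" by (rule ext) simp
  then show ?case using continuation_step[OF Suc adjacent_circle_pt] by simp
qed

text \<open>By \<open>move_move\<close> every initial piece of the polygon collapses to one direct
  move from the start, and vertex 8 is vertex 0.\<close>

lemma circ_trivial: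
  assumes "continuable S (circle_pt s \<delta> 0) F" "fps_conv_radius F \<ge> ereal (3 * \<delta>)"
  shows "circ 8 F = F"
proof -
  have r: "ereal (dist (circle_pt s \<delta> 0) (circle_pt s \<delta> k)) < fps_conv_radius F" for k
  proof -
    have "dist (circle_pt s \<delta> 0) (circle_pt s \<delta> k) < 3 * \<delta>"
      using dist_triangle2[of "circle_pt s \<delta> 0" "circle_pt s \<delta> k" s]
        dist_circle_pt[OF \<delta>_pos, of s k] dist_circle_pt[OF \<delta>_pos, of s 0] \<delta>_pos by linarith
    then show ?thesis using assms(2) by (meson less_ereal.simps(1) less_le_trans)
  qed
  have "circ k F = move (circle_pt s \<delta> 0) (circle_pt s \<delta> k) F" for k
  proof (induction k)
    case 0
    show ?case using r[of 0] by (simp add: zero_ereal_def)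
  next
    case (Suc k)
    have "ereal (dist (circle_pt s \<delta> k) (circle_pt s \<delta> (Suc k))) < fps_conv_radius (circ k F)"
      by (rule adjacent_radius[OF continuation_continuable[OF continuation_circ assms(1)] adjacent_circle_pt])
    then show ?case using r[of k] r[of "Suc k"] unfolding circ.simps(2) Suc by (intro move_move)
  qed
  then show ?thesis using r[of 0] by (simp add: zero_ereal_def)
qed

text \<open>On this disc \<open>1 + x / (z - s)\<close> stays in the right half-plane, so the
  principal branch is differentiable there and the difference \<open>h\<close> has derivative
  zero.\<close>

lemma eval_fps_log_germ:
  assumes "poly_germ z [:-s, 1:] * fps_deriv G = fps_const c" "fps_conv_radius G \<ge> ereal \<delta>"
    "dist z s = \<delta>" "norm x < \<delta>"
  shows "eval_fps G x = fps_nth G 0 + c * Ln (1 + x / (z - s))"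
proof -
  define h where "h x = eval_fps G x - c * Ln (1 + x / (z - s))" for x
  have zs: "z \<noteq> s" "norm (z - s) = \<delta>" using assms(3) \<delta>_pos by (auto simp: dist_norm)
  have der: "(h has_field_derivative 0) (at x within ball 0 \<delta>)" if x: "x \<in> ball 0 \<delta>" for x
  proof -
    have "norm (x / (z - s)) < 1" using x zs \<delta>_pos by (simp add: norm_divide)
    then have "Re (1 + x / (z - s)) > 0" using abs_Re_le_cmod[of "x / (z - s)"] by simp
    then have nr: "1 + x / (z - s) \<notin> \<real>\<^sub>\<le>\<^sub>0" by (auto simp: complex_nonpos_Reals_iff)
    have nz: "z - s + x \<noteq> 0"
    proof
      assume "z - s + x = 0"
      then have "x = - (z - s)" by (simp only: add_eq_0_iff)
      then have "norm x = \<delta>" using zs by (simp only: norm_minus_cancel)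
      then show False using x by simp
    qed
    have xr: "ereal (norm x) < fps_conv_radius G" using x assms(2)
      by (simp add: order_less_le_trans[of "ereal (norm x)" "ereal \<delta>"])
    have xr': "ereal (norm x) < fps_conv_radius (fps_deriv G)" using xr by (simp add: fps_conv_radius_deriv_eq)
    have "poly [:-s, 1:] (z + x) * eval_fps (fps_deriv G) x = eval_fps (poly_germ z [:-s, 1:] * fps_deriv G) x"
      using xr' by (subst eval_fps_mult) auto
    also have "\<dots> = c" unfolding assms(1) by simp
    finally have "(z - s + x) * eval_fps (fps_deriv G) x = c" by (simp add: algebra_simps)
    then have e: "eval_fps (fps_deriv G) x = c / (z - s + x)" using nz by (simp add: field_simps)
    have "((\<lambda>x. Ln (1 + x / (z - s))) has_field_derivative inverse (1 + x / (z - s)) * (1 / (z - s))) (at x)"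
      by (rule DERIV_chain2[where g = "\<lambda>x. 1 + x / (z - s)", OF has_field_derivative_Ln[OF nr]]) (use zs in \<open>auto intro!: derivative_eq_intros\<close>)
    moreover have "(eval_fps G has_field_derivative eval_fps (fps_deriv G) x) (at x)"
      using xr by (intro has_field_derivative_eval_fps) (simp add: in_eball_iff)
    ultimately have D: "(h has_field_derivative eval_fps (fps_deriv G) x - c * (inverse (1 + x / (z - s)) * (1 / (z - s)))) (at x within ball 0 \<delta>)"
      unfolding h_def by (intro has_field_derivative_at_within[OF DERIV_diff] DERIV_cmult)
    have I: "inverse (1 + x / (z - s)) * (1 / (z - s)) = 1 / (z - s + x)"
    proof -
      have "1 + x / (z - s) = (z - s + x) / (z - s)" using zs by (simp add: field_simps)
      then show ?thesis using zs by simp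
    qed
    show ?thesis using D unfolding e I by simp
  qed
  obtain k where k: "\<And>x. x \<in> ball 0 \<delta> \<Longrightarrow> h x = k"
    using has_field_derivative_zero_constant[of "ball 0 \<delta>" h] der by auto
  have "h x = h 0" using k[of x] k[of 0] assms(4) \<delta>_pos by simp
  then show ?thesis by (simp add: h_def eval_fps_at_0 diff_eq_eq)
qed

text \<open>Each move turns the centre about \<open>s\<close> by the angle pi/4 and so adds c i pi/4
  to the constant term. The other coefficients return, because the equation determines the
  derivative.\<close>

lemma circ_log_germ:
  assumes F: "continuable S (circle_pt s \<delta> 0) F"
    and log: "poly_germ (circle_pt s \<delta> 0) [:-s, 1:] * fps_deriv F = fps_const c"
  shows "circ 8 F = F + fps_const (2 * of_real pi * \<i> * c)"
proof -
  have Ci: "continuable S (circle_pt s \<delta> k) (circ k F)" for k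
    by (rule continuation_continuable[OF continuation_circ F])
  have L: "poly_germ (circle_pt s \<delta> k) [:-s, 1:] * fps_deriv (circ k F) = fps_const c" for k
    using continuation_mult[OF continuation_circ continuable_poly_germ continuable_deriv[OF F], of k "[:-s, 1:]"]
    unfolding log continuation_const[OF continuation_circ] continuation_poly_germ[OF continuation_circ]
      continuation_deriv[OF continuation_circ F] by simp
  have step: "fps_nth (circ (Suc k) F) 0 = fps_nth (circ k F) 0 + c * (\<i> * of_real (pi / 4))" for k
  proof -
    let ?z = "circle_pt s \<delta> k" and ?u = "circle_pt s \<delta> (Suc k)"
    have r: "fps_conv_radius (circ k F) \<ge> ereal \<delta>"
      using continuable_radius[OF Ci, of k] infdist_circle_pt[of k] by (meson ereal_less_eq(3) order_trans)
    have "fps_nth (circ (Suc k) F) 0 = eval_fps (circ k F) (?u + 0 - ?z)"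
      using has_fps_expansion_imp_0_eq_fps_nth_0[OF move_has_fps_expansion[OF adjacent_radius[OF Ci adjacent_circle_pt]]]
      by simp
    also have "\<dots> = fps_nth (circ k F) 0 + c * Ln (1 + (?u + 0 - ?z) / (?z - s))"
      by (rule eval_fps_log_germ[OF L r dist_circle_pt[OF \<delta>_pos]])
         (use dist_circle_pt_Suc[OF \<delta>_pos, of s k] in \<open>simp add: dist_norm norm_minus_commute\<close>)
    also have "1 + (?u + 0 - ?z) / (?z - s) = exp (\<i> * of_real (pi / 4))"
      using \<delta>_pos by (simp add: circle_pt_def field_simps cis_conv_exp)
    also have "Ln \<dots> = \<i> * of_real (pi / 4)"
      by (rule Ln_exp) (use pi_gt_zero in \<open>auto simp: field_simps\<close>)
    finally show ?thesis .
  qed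
  have const: "fps_nth (circ k F) 0 = fps_nth F 0 + of_nat k * (c * (\<i> * of_real (pi / 4)))" for k
    by (induction k) (simp, simp only: step, simp add: algebra_simps)
  show ?thesis
  proof (rule fps_ext)
    have "poly_germ (circle_pt s \<delta> 0) [:-s, 1:] * fps_deriv (circ 8 F) = poly_germ (circle_pt s \<delta> 0) [:-s, 1:] * fps_deriv F"
      using L[of 8] log by simp
    then have d: "fps_deriv (circ 8 F) = fps_deriv F" by simp
    fix n
    show "fps_nth (circ 8 F) n = fps_nth (F + fps_const (2 * of_real pi * \<i> * c)) n"
    proof (cases n)
      case 0
      then show ?thesis using const[of 8] by (simp add: algebra_simps)
    next
      case (Suc m)
      have "fps_nth (fps_deriv (circ 8 F)) m = fps_nth (fps_deriv F) m" by (simp only: d)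
      then show ?thesis using Suc by (simp del: circ.simps of_nat_Suc)
    qed
  qed
qed

end

text \<open>A lasso: go from \<open>z\<close> to a small circle around \<open>s\<close>, run round
  it, return by the inverse path. The equation (x - s) F' = c and the constants are carried along
  unchanged, so the jump is that of the circle.\<close>

lemma loop_exists:
  assumes "finite S" "s \<in> S" "S - {s} \<noteq> {}" "z \<notin> S"
  obtains T where "continuation S z z T"
    and "\<And>F. continuable (S - {s}) z F \<Longrightarrow> T F = F"
    and "\<And>F c. continuable S z F \<Longrightarrow> poly_germ z [:-s, 1:] * fps_deriv F = fps_const c \<Longrightarrow>
           T F = F + fps_const (2 * of_real pi * \<i> * c)"
proof -
  have "closed (S - {s})" using assms(1) by (intro finite_imp_closed) auto
  then have d: "infdist s (S - {s}) > 0"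
    using assms(3) by (metis Diff_iff in_closed_iff_infdist_zero infdist_nonneg insertI1 less_eq_real_def)
  define \<delta> where "\<delta> = infdist s (S - {s}) / 4"
  interpret isolated_point S s \<delta>
    by unfold_locales (use assms d in \<open>auto simp: \<delta>_def intro: infdist_le\<close>)
  let ?u = "circle_pt s \<delta> 0"
  have "infdist ?u S > 0" using infdist_circle_pt[of 0] \<delta>_pos by linarith
  then have "?u \<notin> S" by auto
  then obtain P where P: "continuation S z ?u P" using continuation_exists[of S z ?u] assms by auto
  from continuation_inverse[OF P] obtain P' where P': "continuation S ?u z P'"
    "\<And>F. continuable S z F \<Longrightarrow> P' (P F) = F" by blast
  have c8: "continuation S ?u ?u (circ 8)" using continuation_circ[of 8] by simp
  show thesis
  proof (rule that[of "\<lambda>F. P' (circ 8 (P F))"])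
    show "continuation S z z (\<lambda>F. P' (circ 8 (P F)))"
      by (rule continuation_trans[OF P'(1) continuation_trans[OF c8 P]])
    show "P' (circ 8 (P F)) = F" if F: "continuable (S - {s}) z F" for F
    proof -
      have FS: "continuable S z F" by (rule continuable_mono[OF F]) (use assms in auto)
      have "continuable (S - {s}) ?u (P F)"
        by (rule continuation_continuable[OF continuation_mono[OF P] F]) (use assms in auto)
      then have "fps_conv_radius (P F) \<ge> ereal (3 * \<delta>)"
        using continuable_radius infdist_circle_pt_Diff[OF assms(3), of 0] by (meson ereal_less_eq(3) order_trans)
      then have "circ 8 (P F) = P F" by (intro circ_trivial continuation_continuable[OF P FS])
      then show ?thesis using P'(2)[OF FS] by simp
    qed
    show "P' (circ 8 (P F)) = F + fps_const (2 * of_real pi * \<i> * c)"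
      if F: "continuable S z F" and l: "poly_germ z [:-s, 1:] * fps_deriv F = fps_const c" for F c
    proof -
      have PF: "continuable S ?u (P F)" by (rule continuation_continuable[OF P F])
      have "poly_germ ?u [:-s, 1:] * fps_deriv (P F) = fps_const c"
        using continuation_mult[OF P continuable_poly_germ continuable_deriv[OF F], of "[:-s, 1:]"]
        unfolding l continuation_const[OF P] continuation_poly_germ[OF P] continuation_deriv[OF P F] by simp
      from circ_log_germ[OF PF this] have "P' (circ 8 (P F)) = P' (P F + fps_const (2 * of_real pi * \<i> * c))" by simp
      also have "\<dots> = P' (P F) + fps_const (2 * of_real pi * \<i> * c)"
        unfolding continuation_add[OF P'(1) PF continuable_const] continuation_const[OF P'(1)] ..
      finally show ?thesis using P'(2)[OF F] by simp
    qed
  qed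
qed

section \<open>Iterated logarithmic integrals\<close>

text \<open>The differential form of an iterated integral: each layer strips off one integration
  against \<open>dx / (x - a i)\<close>, the outermost first. Towers ending in a constant describe
  such integrals without fixing constants of integration.\<close>

primrec log_tower :: "(nat \<Rightarrow> complex) \<Rightarrow> complex \<Rightarrow> nat \<Rightarrow> complex fps \<Rightarrow> complex fps" where
  "log_tower a z 0 F = F"
| "log_tower a z (Suc i) F = poly_germ z [:- a i, 1:] * fps_deriv (log_tower a z i F)"

lemma continuable_log_tower: "continuable S z F \<Longrightarrow> continuable S z (log_tower a z i F)"
  by (induction i) (auto intro: continuable_mult continuable_deriv continuable_poly_germ)

lemma continuation_log_tower:
  assumes "continuation S z u T" "continuable S z F"
  shows "T (log_tower a z i F) = log_tower a u i (T F)"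
proof (induction i)
  case (Suc i)
  then show ?case
    using continuable_log_tower[OF assms(2), of a i]
    by (simp add: continuation_mult[OF assms(1)] continuation_deriv[OF assms(1)] continuable_deriv
        continuable_poly_germ continuation_poly_germ[OF assms(1)])
qed simp

lemma log_tower_diff: "log_tower a z i (F - G) = log_tower a z i F - log_tower a z i G"
  by (induction i) (auto simp: right_diff_distrib)

lemma fps_deriv_eq_0_const: "fps_deriv F = 0 \<Longrightarrow> F = fps_const (fps_nth (F :: complex fps) 0)"
  by (simp add: fps_deriv_eq_0_iff)

text \<open>A loop leaves the constant at the top unchanged, so the top layer of the difference
  vanishes and the layer below has derivative zero.\<close>

lemma log_tower_unipotent:
  assumes "continuation S z z T" "continuable S z y" "log_tower a z (Suc i) y = fps_const c"
  shows "\<exists>c'. log_tower a z i (T y - y) = fps_const c'"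
proof -
  have "log_tower a z (Suc i) (T y) = fps_const c"
    using continuation_log_tower[OF assms(1,2), of a "Suc i"] assms(3) continuation_const[OF assms(1)] by metis
  then have "log_tower a z (Suc i) (T y - y) = 0" unfolding log_tower_diff assms(3) by simp
  then have "fps_deriv (log_tower a z i (T y - y)) = 0" by auto
  then show ?thesis by (blast dest: fps_deriv_eq_0_const)
qed

text \<open>Undoing a layer means dividing by \<open>x - a i\<close> and integrating, which creates
  no singularity other than \<open>a i\<close>. Hence such a germ continues across any point that is
  not among its poles.\<close>

lemma continuable_of_log_tower:
  assumes "continuable S z (log_tower a z i y)" "\<And>k. k < i \<Longrightarrow> a k \<in> S" "infdist z S > 0"
  shows "continuable S z y"
  using assms
proof (induction i)
  case (Suc i)
  have "continuable S z (fps_deriv (log_tower a z i y))"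
    by (rule continuable_quotient_poly_germ[where p = "[:- a i, 1:]" and H = "log_tower a z (Suc i) y"])
       (use Suc.prems in auto)
  then show ?case using Suc by (auto intro: continuable_primitive)
qed simp

text \<open>
  Let \<open>t\<close> be the loop around \<open>a (Suc i)\<close> and \<open>b\<close> the commutator built so far. Because the poles are
  distinct, \<open>t\<close> fixes every germ whose tower becomes constant after \<open>Suc i\<close> steps. For \<open>y\<close> of one
  step more, \<open>h = t y - y\<close> and \<open>b y - y\<close> are of this kind, so all that survives in the commutator of
  \<open>t\<close> and \<open>b\<close> is the constant \<open>b h - h\<close>.
\<close>

lemma iterated_commutator_exists:
  assumes S: "finite S" "z \<notin> S" "\<And>i. i < M \<Longrightarrow> a i \<in> S" "inj_on a {..<M}" "\<And>i. i < M \<Longrightarrow> S - {a i} \<noteq> {}"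
    and "i < M"
  shows "\<exists>w \<kappa>. continuation S z z w \<and> \<kappa> \<noteq> 0 \<and>
    (\<forall>y c. continuable S z y \<longrightarrow> log_tower a z (Suc i) y = fps_const c \<longrightarrow> w y = y + fps_const (\<kappa> * c)) \<and>
    (\<forall>j\<le>i. \<forall>F. continuable (S - {a j}) z F \<longrightarrow> w F = F)"
  using \<open>i < M\<close>
proof (induction i)
  case 0
  obtain T where T: "continuation S z z T" "\<And>F. continuable (S - {a 0}) z F \<Longrightarrow> T F = F"
    "\<And>F c. continuable S z F \<Longrightarrow> poly_germ z [:-a 0, 1:] * fps_deriv F = fps_const c \<Longrightarrow>
           T F = F + fps_const (2 * of_real pi * \<i> * c)"
    using loop_exists[of S "a 0" z] S 0 by metis
  then show ?case by (intro exI[of _ T] exI[of _ "2 * of_real pi * \<i>"]) auto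
next
  case (Suc i)
  then obtain b \<kappa> where b: "continuation S z z b" "\<kappa> \<noteq> 0"
    "\<And>y c. continuable S z y \<Longrightarrow> log_tower a z (Suc i) y = fps_const c \<Longrightarrow> b y = y + fps_const (\<kappa> * c)"
    "\<And>j F. j \<le> i \<Longrightarrow> continuable (S - {a j}) z F \<Longrightarrow> b F = F" by auto
  have iM: "Suc i < M" using Suc by simp
  obtain t where t: "continuation S z z t" "\<And>F. continuable (S - {a (Suc i)}) z F \<Longrightarrow> t F = F"
    "\<And>F c. continuable S z F \<Longrightarrow> poly_germ z [:-a (Suc i), 1:] * fps_deriv F = fps_const c \<Longrightarrow>
           t F = F + fps_const (2 * of_real pi * \<i> * c)"
    using loop_exists[OF S(1) S(3)[OF iM] S(5)[OF iM] S(2)] by metis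
  obtain b' where b': "continuation S z z b'" "\<And>F. continuable S z F \<Longrightarrow> b' (b F) = F"
    using continuation_inverse[OF b(1)] by blast
  obtain t' where t': "continuation S z z t'" "\<And>F. continuable S z F \<Longrightarrow> t' (t F) = F"
    using continuation_inverse[OF t(1)] by blast
  note cont = continuation_continuable[OF b(1)] continuation_continuable[OF t(1)]
    continuation_continuable[OF b'(1)] continuation_continuable[OF t'(1)]
  have t_triv: "t y = y" if y: "continuable S z y" "log_tower a z (Suc i) y = fps_const c" for y c
  proof (rule t(2), rule continuable_of_log_tower)
    show "continuable (S - {a (Suc i)}) z (log_tower a z (Suc i) y)" unfolding y by (rule continuable_const)
    show "a k \<in> S - {a (Suc i)}" if "k < Suc i" for k
      using that S(3)[of k] S(4) iM unfolding inj_on_def by force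
    have "closed (S - {a (Suc i)})" using S(1) by (intro finite_imp_closed) auto
    then show "infdist z (S - {a (Suc i)}) > 0"
      using S(2) S(5)[OF iM] by (metis Diff_iff in_closed_iff_infdist_zero infdist_nonneg less_eq_real_def)
  qed
  have c1: "b' (t' (b (t y))) = y + fps_const (2 * of_real pi * \<i> * \<kappa> * c)"
    if y: "continuable S z y" and tow: "log_tower a z (Suc (Suc i)) y = fps_const c" for y c
  proof -
    define h where "h = t y - y"
    define u where "u = b y - y"
    define e where "e = 2 * of_real pi * \<i> * c"
    have cy: "continuable S z h" "continuable S z u"
      unfolding h_def u_def using y cont by (auto intro: continuable_diff)
    \<comment> \<open>The layer below the constant \<open>c\<close> is a logarithm at
      \<open>a (Suc i)\<close>, hence the jump \<open>e\<close>.\<close>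
    have "t (log_tower a z (Suc i) y) = log_tower a z (Suc i) y + fps_const e"
      unfolding e_def using tow by (intro t(3) continuable_log_tower y) simp
    then have h: "log_tower a z (Suc i) h = fps_const e"
      unfolding h_def log_tower_diff continuation_log_tower[OF t(1) y] by simp
    obtain c' where u: "log_tower a z (Suc i) u = fps_const c'"
      unfolding u_def using log_tower_unipotent[OF b(1) y tow] by blast
    have th: "t h = h" "t u = u" using t_triv cy h u by blast+
    have t'h: "t' h = h" "t' u = u" using t'(2)[OF cy(1)] t'(2)[OF cy(2)] th by simp_all
    \<comment> \<open>Since \<open>t\<close> adds \<open>h\<close> to \<open>y\<close> and fixes
      \<open>h\<close>, its inverse subtracts \<open>h\<close>.\<close>
    have t'y: "t' y = y - h"
    proof -
      have "t (y - h) = t y - t h" by (rule continuation_diff[OF t(1) y cy(1)])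
      then have "t (y - h) = y" by (simp add: th) (simp add: h_def)
      then show ?thesis using t'(2)[OF continuable_diff[OF y cy(1)]] by simp
    qed
    have "b (t y) = b (y + h)" by (simp add: h_def)
    also have "\<dots> = b y + b h" by (rule continuation_add[OF b(1) y cy(1)])
    also have "\<dots> = y + u + (h + fps_const (\<kappa> * e))" using b(3)[OF cy(1) h] by (simp add: u_def)
    finally have "t' (b (t y)) = t' (y + u + (h + fps_const (\<kappa> * e)))" by simp
    also have "\<dots> = (y - h) + u + (h + fps_const (\<kappa> * e))"
      using y cy by (simp add: continuation_add[OF t'(1)] continuable_add continuable_const
          continuation_const[OF t'(1)] t'h t'y)
    also have "\<dots> = b y + fps_const (\<kappa> * e)" by (simp add: u_def)
    finally have "b' (t' (b (t y))) = b' (b y + fps_const (\<kappa> * e))" by simp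
    also have "\<dots> = y + fps_const (\<kappa> * e)"
      unfolding continuation_add[OF b'(1) cont(1)[OF y] continuable_const] b'(2)[OF y] continuation_const[OF b'(1)] ..
    finally show ?thesis by (simp add: e_def mult_ac)
  qed
  \<comment> \<open>One factor is trivial on \<open>F\<close>, but it must be trivial again when
    applied after the other one. This holds because \<open>b F\<close> and \<open>t F\<close> still
    continue outside \<open>S - {a j}\<close>.\<close>
  have c2: "b' (t' (b (t F))) = F" if j: "j \<le> Suc i" and F': "continuable (S - {a j}) z F" for j F
  proof -
    have jM: "j < M" using j iM by simp
    have F: "continuable S z F" by (rule continuable_mono[OF F']) (use S(5)[OF jM] in auto)
    show ?thesis
    proof (cases "j = Suc i")
      case True
      have "continuable (S - {a j}) z (b F)"
        by (rule continuation_continuable[OF continuation_mono[OF b(1)] F']) (use S(5)[OF jM] in auto)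
      then have "t (b F) = b F" using t(2) True by simp
      then have "t' (b F) = b F" using t'(2)[OF cont(1)[OF F]] by simp
      then show ?thesis using t(2) F' True b'(2)[OF F] by simp
    next
      case False
      then have ji: "j \<le> i" using j by simp
      have "continuable (S - {a j}) z (t F)"
        by (rule continuation_continuable[OF continuation_mono[OF t(1)] F']) (use S(5)[OF jM] in auto)
      then have "b (t F) = t F" "b F = F" using b(4)[OF ji] F' by simp_all
      then show ?thesis using t'(2)[OF F] b'(2)[OF F] by simp
    qed
  qed
  show ?case
  proof (intro exI conjI allI impI)
    show "continuation S z z (\<lambda>F. b' (t' (b (t F))))"
      by (rule continuation_trans[OF b'(1) continuation_trans[OF t'(1) continuation_trans[OF b(1) t(1)]]])
    show "2 * of_real pi * \<i> * \<kappa> \<noteq> 0" using b(2) by simp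
  qed (use c1 c2 in blast)+
qed

section \<open>Algebraic elements over a field of fractions\<close>

text \<open>Stated for an arbitrary set so that it applies both to a ring of germs and to its
  fraction field. The nonzero coefficient need not be the leading one, which spares
  normalisation.\<close>

definition algebraic_over :: "'a::comm_ring_1 set \<Rightarrow> 'a \<Rightarrow> bool" where
  "algebraic_over E x \<longleftrightarrow> (\<exists>n c. (\<forall>i\<le>n. c i \<in> E) \<and> (\<exists>i\<le>n. c i \<noteq> 0) \<and> (\<Sum>i\<le>n. c i * x ^ i) = 0)"

definition is_subfield :: "'a::Fields.field set \<Rightarrow> bool" where
  "is_subfield K \<longleftrightarrow> 1 \<in> K \<and> (\<forall>x\<in>K. - x \<in> K \<and> inverse x \<in> K) \<and> (\<forall>x\<in>K. \<forall>y\<in>K. x + y \<in> K \<and> x * y \<in> K)"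

text \<open>A bridge to the set-based algebra of HOL-Algebra, whose theorem that the algebraic
  elements over a subfield form a subfield is wanted for types.\<close>

lemma is_subfield_ring_of_type_algebra:
  "subfield K (ring_of_type_algebra :: 'a::Fields.field ring) \<longleftrightarrow> is_subfield K"
proof -
  let ?R = "ring_of_type_algebra :: 'a ring"
  interpret R: Ring.field ?R by (rule field_from_type_algebra)
  have sel: "carrier ?R = UNIV" "monoid.mult ?R = (*)" "ring.zero ?R = 0" "one ?R = 1" "ring.add ?R = (+)"
    by (auto simp: ring_of_type_algebra_def)
  have neg: "a_inv ?R x = - x" for x
    using R.minus_equality[of "-x" x] by (simp add: sel)
  have inv: "m_inv ?R x = inverse x" if "x \<noteq> 0" for x
    using R.inv_unique'[of x "inverse x"] that by (simp add: sel)
  show ?thesis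
  proof
    assume K: "subfield K ?R"
    note KE = subringE[OF subfieldE(1)[OF K]]
    have "inverse x \<in> K" if "x \<in> K" for x
      using R.subfield_m_inv(1)[OF K, of x] that inv[of x] KE(2) by (cases "x = 0") (auto simp: sel)
    then show "is_subfield K" using KE by (auto simp: is_subfield_def sel neg)
  next
    assume K: "is_subfield K"
    show "subfield K ?R"
      by (rule R.subfieldI'[OF R.subringI]) (use K in \<open>auto simp: is_subfield_def sel neg inv\<close>)
  qed
qed

lemma algebraic_over_ring_of_type_algebra:
  fixes K :: "'a::Fields.field set"
  assumes K: "is_subfield K"
  shows "(ring.algebraic ring_of_type_algebra over K) x \<longleftrightarrow> algebraic_over K x"
proof -
  let ?R = "ring_of_type_algebra :: 'a ring"
  interpret R: Ring.field ?R by (rule field_from_type_algebra)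
  have sel: "carrier ?R = UNIV" "monoid.mult ?R = (*)" "ring.zero ?R = 0" "one ?R = 1" "ring.add ?R = (+)"
    by (auto simp: ring_of_type_algebra_def)
  have pow: "x [^]\<^bsub>?R\<^esub> (n::nat) = x ^ n" for x n
    by (induction n) (auto simp: sel R.nat_pow_Suc)
  have eval: "R.eval (map c (rev [0..<n])) x = (\<Sum>i<n. c i * x ^ i)" for c x n
    by (induction n) (auto simp: sel pow add.commute)
  show ?thesis
  proof
    assume "(R.algebraic over K) x"
    moreover have "subring K ?R" using K by (simp add: subfieldE(1) is_subfield_ring_of_type_algebra)
    ultimately obtain p where p: "p \<in> carrier (K[X]\<^bsub>?R\<^esub>)" "p \<noteq> []" "R.eval p x = \<zero>\<^bsub>?R\<^esub>"
      using R.algebraicE[of K x] by (auto simp: sel)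
    define c where "c i = rev p ! i" for i
    obtain n where n: "length p = Suc n" using p(2) by (cases p) auto
    have pc: "p = map c (rev [0..<Suc n])"
      by (rule nth_equalityI) (auto simp: n c_def rev_nth simp del: upt_Suc)
    have "set p \<subseteq> K" "hd p \<noteq> 0" using p(1,2) by (auto simp: univ_poly_def polynomial_def sel)
    have "c i \<in> K" if "i \<le> n" for i
      using that \<open>set p \<subseteq> K\<close> n unfolding c_def by (metis le_imp_less_Suc length_rev nth_mem set_rev subsetD)
    moreover have "c n \<noteq> 0" using \<open>hd p \<noteq> 0\<close> unfolding pc by simp
    moreover have "(\<Sum>i\<le>n. c i * x ^ i) = 0"
      using p(3) eval[of c "Suc n" x] unfolding pc[symmetric] by (simp add: sel lessThan_Suc_atMost)
    ultimately show "algebraic_over K x" unfolding algebraic_over_def by blast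
  next
    assume "algebraic_over K x"
    then obtain n c where c: "\<And>i. i \<le> n \<Longrightarrow> c i \<in> K" "\<exists>i\<le>n. c i \<noteq> 0" "(\<Sum>i\<le>n. c i * x ^ i) = 0"
      unfolding algebraic_over_def by blast
    \<comment> \<open>List polynomials start with a nonzero leading coefficient, so the relation is
      cut off at its last nonzero term and the list reversed.\<close>
    define m where "m = (GREATEST i. i \<le> n \<and> c i \<noteq> 0)"
    have m: "m \<le> n" "c m \<noteq> 0" using GreatestI_ex_nat[of "\<lambda>i. i \<le> n \<and> c i \<noteq> 0" n] c(2) by (auto simp: m_def)
    have "c i = 0" if "m < i" "i \<le> n" for i
      using Greatest_le_nat[of "\<lambda>i. i \<le> n \<and> c i \<noteq> 0" i n] that by (force simp: m_def)
    then have "(\<Sum>i<Suc m. c i * x ^ i) = (\<Sum>i\<le>n. c i * x ^ i)"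
      using m by (intro sum.mono_neutral_left) (auto simp: not_less_eq)
    then have "R.eval (map c (rev [0..<Suc m])) x = \<zero>\<^bsub>?R\<^esub>" using c(3) by (simp only: eval sel)
    moreover have "map c (rev [0..<Suc m]) \<in> carrier (K[X]\<^bsub>?R\<^esub>)"
      using m c(1) by (auto simp: univ_poly_def polynomial_def sel)
    ultimately show "(R.algebraic over K) x" by (intro R.algebraicI) auto
  qed
qed

lemma algebraic_over_field_closed:
  fixes K :: "'a::Fields.field set"
  assumes K: "is_subfield K"
  shows "is_subfield {x. algebraic_over K x}"
proof -
  interpret R: Ring.field "ring_of_type_algebra :: 'a ring" by (rule field_from_type_algebra)
  show ?thesis
    using R.subfield_of_algebraics[of K] K
    by (simp add: is_subfield_ring_of_type_algebra algebraic_over_ring_of_type_algebra[OF K])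
       (simp add: ring_of_type_algebra_def)
qed

section \<open>Fraction fields of rings of power series\<close>

lemma fps_to_fls_sum: "fps_to_fls (sum f A) = (\<Sum>i\<in>A. fps_to_fls (f i))"
  by (induction A rule: infinite_finite_induct) auto

locale fps_subring =
  fixes E :: "'a::Fields.field fps set"
  assumes one: "1 \<in> E" and add: "\<And>F G. F \<in> E \<Longrightarrow> G \<in> E \<Longrightarrow> F + G \<in> E"
    and mult: "\<And>F G. F \<in> E \<Longrightarrow> G \<in> E \<Longrightarrow> F * G \<in> E" and neg: "\<And>F. F \<in> E \<Longrightarrow> - F \<in> E"
begin

lemma prod_closed: "finite A \<Longrightarrow> (\<And>i. i \<in> A \<Longrightarrow> f i \<in> E) \<Longrightarrow> prod f A \<in> E"
  by (induction A rule: finite_induct) (auto intro: one mult)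

definition frac :: "'a fls set" where
  "frac = {fps_to_fls F / fps_to_fls G | F G. F \<in> E \<and> G \<in> E \<and> G \<noteq> 0}"

lemma fracI: "F \<in> E \<Longrightarrow> G \<in> E \<Longrightarrow> G \<noteq> 0 \<Longrightarrow> fps_to_fls F / fps_to_fls G \<in> frac"
  by (auto simp: frac_def)

lemma is_subfield_frac: "is_subfield frac"
  unfolding is_subfield_def
proof (intro conjI ballI)
  show "1 \<in> frac" using fracI[OF one one] by simp
  fix x assume "x \<in> frac"
  then obtain F G where x: "x = fps_to_fls F / fps_to_fls G" "F \<in> E" "G \<in> E" "G \<noteq> 0" by (auto simp: frac_def)
  show "- x \<in> frac" using fracI[OF neg[OF x(2)] x(3,4)] by (simp add: x(1))
  have "0 \<in> E" using add[OF one neg[OF one]] by simp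
  then show "inverse x \<in> frac"
    using fracI[OF x(3) x(2)] fracI[OF _ one, of 0] by (cases "F = 0") (auto simp: x(1))
  fix y assume "y \<in> frac"
  then obtain F' G' where y: "y = fps_to_fls F' / fps_to_fls G'" "F' \<in> E" "G' \<in> E" "G' \<noteq> 0" by (auto simp: frac_def)
  show "x + y \<in> frac"
    using fracI[of "F * G' + F' * G" "G * G'"] x y
    by (simp add: add mult add_frac_eq fls_times_fps_to_fls)
  show "x * y \<in> frac"
    using fracI[of "F * F'" "G * G'"] x y by (simp add: mult fls_times_fps_to_fls)
qed

text \<open>Denominators are cleared with their product \<open>D\<close>. This transfers the closure
  properties from the field of fractions back to germs.\<close>

lemma algebraic_over_frac_iff:
  "algebraic_over frac (fps_to_fls x) \<longleftrightarrow> algebraic_over E x"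
proof
  assume "algebraic_over E x"
  then obtain n c where c: "\<And>i. i \<le> n \<Longrightarrow> c i \<in> E" "\<exists>i\<le>n. c i \<noteq> 0" "(\<Sum>i\<le>n. c i * x ^ i) = 0"
    unfolding algebraic_over_def by blast
  have "(\<Sum>i\<le>n. fps_to_fls (c i) * fps_to_fls x ^ i) = fps_to_fls (\<Sum>i\<le>n. c i * x ^ i)"
    by (simp add: fps_to_fls_sum fls_times_fps_to_fls fps_to_fls_power)
  then show "algebraic_over frac (fps_to_fls x)"
    unfolding algebraic_over_def using c fracI[OF _ one]
    by (intro exI[of _ n] exI[of _ "\<lambda>i. fps_to_fls (c i)"]) auto
next
  assume "algebraic_over frac (fps_to_fls x)"
  then obtain n c where c: "\<And>i. i \<le> n \<Longrightarrow> c i \<in> frac" "\<exists>i\<le>n. c i \<noteq> 0" "(\<Sum>i\<le>n. c i * fps_to_fls x ^ i) = 0"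
    unfolding algebraic_over_def by blast
  have "\<forall>i\<in>{..n}. \<exists>F G. c i = fps_to_fls F / fps_to_fls G \<and> F \<in> E \<and> G \<in> E \<and> G \<noteq> 0"
    using c(1) by (auto simp: frac_def)
  then obtain F G where FG: "\<And>i. i \<le> n \<Longrightarrow> c i = fps_to_fls (F i) / fps_to_fls (G i)"
    "\<And>i. i \<le> n \<Longrightarrow> F i \<in> E" "\<And>i. i \<le> n \<Longrightarrow> G i \<in> E" "\<And>i. i \<le> n \<Longrightarrow> G i \<noteq> 0"
    by (metis (no_types, lifting) atMost_iff)
  define D where "D = prod G {..n}"
  have D0: "D \<noteq> 0" using FG(4) by (simp add: D_def)
  define e where "e i = F i * prod G ({..n} - {i})" for i
  have e: "fps_to_fls (e i) = fps_to_fls D * c i" if "i \<le> n" for i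
  proof -
    have "D = G i * prod G ({..n} - {i})" unfolding D_def using that by (intro prod.remove) auto
    then show ?thesis using FG(1)[OF that] FG(4)[OF that] by (simp add: e_def fls_times_fps_to_fls)
  qed
  have "e i \<in> E" if "i \<le> n" for i
    unfolding e_def using FG that by (intro mult prod_closed) auto
  moreover have "\<exists>i\<le>n. e i \<noteq> 0" using c(2) e D0 by (metis fps_to_fls_eq_0_iff mult_eq_0_iff)
  moreover have "fps_to_fls (\<Sum>i\<le>n. e i * x ^ i) = fps_to_fls D * (\<Sum>i\<le>n. c i * fps_to_fls x ^ i)"
    by (simp add: fps_to_fls_sum fls_times_fps_to_fls fps_to_fls_power e sum_distrib_left mult.assoc)
  then have "(\<Sum>i\<le>n. e i * x ^ i) = 0" using c(3) by simp
  ultimately show "algebraic_over E x" unfolding algebraic_over_def by blast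
qed

lemma algebraic_over_add: "algebraic_over E F \<Longrightarrow> algebraic_over E G \<Longrightarrow> algebraic_over E (F + G)"
  and algebraic_over_mult: "algebraic_over E F \<Longrightarrow> algebraic_over E G \<Longrightarrow> algebraic_over E (F * G)"
  using algebraic_over_field_closed[OF is_subfield_frac]
  unfolding is_subfield_def algebraic_over_frac_iff[symmetric] fps_to_fls_plus fls_times_fps_to_fls mem_Collect_eq
  by blast+

lemma algebraic_over_quotient:
  assumes "algebraic_over E F" "algebraic_over E G" "G \<noteq> 0" "H * G = F"
  shows "algebraic_over E H"
proof -
  have "fps_to_fls H = fps_to_fls F * inverse (fps_to_fls G)"
    using assms(3) by (simp flip: assms(4) add: fls_times_fps_to_fls)
  moreover have "algebraic_over frac (fps_to_fls F * inverse (fps_to_fls G))"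
    using algebraic_over_field_closed[OF is_subfield_frac] assms(1,2)
    unfolding is_subfield_def algebraic_over_frac_iff[symmetric] mem_Collect_eq by blast
  ultimately show ?thesis unfolding algebraic_over_frac_iff[symmetric] by simp
qed

lemma algebraic_over_self:
  assumes "F \<in> E" shows "algebraic_over E F"
  unfolding algebraic_over_def
proof (intro exI conjI allI impI)
  let ?c = "\<lambda>i::nat. if i = 0 then - F else 1"
  show "?c i \<in> E" for i using assms by (simp add: one neg)
  show "(1::nat) \<le> 1" "?c 1 \<noteq> 0" by simp_all
  show "(\<Sum>i\<le>1. ?c i * F ^ i) = 0" by simp
qed

lemma algebraic_over_sum: "(\<And>i. i \<in> A \<Longrightarrow> algebraic_over E (f i)) \<Longrightarrow> algebraic_over E (sum f A)"
proof (induction A rule: infinite_finite_induct)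
  have "0 \<in> E" using add[OF one neg[OF one]] by simp
  then have "algebraic_over E 0" by (rule algebraic_over_self)
  then show "algebraic_over E (sum f {})" "infinite A \<Longrightarrow> algebraic_over E (sum f A)" for A by simp_all
qed (auto intro: algebraic_over_add)

lemma algebraic_over_prod: "(\<And>i. i \<in> A \<Longrightarrow> algebraic_over E (f i)) \<Longrightarrow> algebraic_over E (prod f A)"
  by (induction A rule: infinite_finite_induct) (auto intro: algebraic_over_mult algebraic_over_self one)

lemma algebraic_over_power: "algebraic_over E F \<Longrightarrow> algebraic_over E (F ^ n)"
  by (induction n) (auto intro: algebraic_over_mult algebraic_over_self one)

end

text \<open>In characteristic 0 the translates are pairwise distinct roots of one nonzero polynomial
  over an integral domain, which has only finitely many.\<close>

lemma not_algebraic_over_translates: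
  fixes x :: "'a::field_char_0 fps"
  assumes "\<And>m n c. (\<And>i. i \<le> n \<Longrightarrow> c i \<in> E) \<Longrightarrow> (\<Sum>i\<le>n. c i * x ^ i) = 0 \<Longrightarrow> (\<Sum>i\<le>n. c i * (x + fps_const (of_nat m * \<kappa>)) ^ i) = 0"
    and "\<kappa> \<noteq> 0"
  shows "\<not> algebraic_over E x"
proof
  assume "algebraic_over E x"
  then obtain n c where c: "\<And>i. i \<le> n \<Longrightarrow> c i \<in> E" "\<exists>i\<le>n. c i \<noteq> 0" "(\<Sum>i\<le>n. c i * x ^ i) = 0"
    unfolding algebraic_over_def by blast
  define q where "q = (\<Sum>i\<le>n. monom (c i) i)"
  have q: "poly q y = (\<Sum>i\<le>n. c i * y ^ i)" for y by (simp add: q_def poly_sum poly_monom)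
  have "coeff q i = c i" if "i \<le> n" for i
    using that by (simp add: q_def coeff_sum)
  then have "q \<noteq> 0" using c(2) by force
  then have "finite {y. poly q y = 0}" by (rule poly_roots_finite)
  moreover have "range (\<lambda>m. x + fps_const (of_nat m * \<kappa>)) \<subseteq> {y. poly q y = 0}"
    using assms(1)[OF c(1) c(3)] by (auto simp: q)
  ultimately have "finite (range (\<lambda>m::nat. x + fps_const (of_nat m * \<kappa>)))" by (rule rev_finite_subset)
  moreover have "inj (\<lambda>m::nat. x + fps_const (of_nat m * \<kappa>))"
    using assms(2) by (auto intro!: injI)
  ultimately show False using finite_imageD by blast
qed

section \<open>Monodromy and algebraic dependence\<close>

lemma continuation_power:
  assumes "continuation S z u T" "continuable S z F"
  shows "T (F ^ n) = T F ^ n \<and> continuable S z (F ^ n)"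
proof (induction n)
  case 0
  show ?case using continuation_const[OF assms(1), of 1] continuable_const[of S z 1] by simp
next
  case (Suc n)
  then show ?case using assms by (simp add: continuation_mult continuable_mult)
qed

lemma continuation_sum:
  assumes "continuation S z u T" "finite A" "\<And>i. i \<in> A \<Longrightarrow> continuable S z (f i)"
  shows "T (sum f A) = (\<Sum>i\<in>A. T (f i)) \<and> continuable S z (sum f A)"
  using assms(2,3)
proof (induction A rule: finite_induct)
  case empty
  show ?case using continuation_const[OF assms(1), of 0] continuable_const[of S z 0] by simp
next
  case (insert i A)
  then show ?case using assms(1) by (simp add: continuation_add continuable_add)
qed

text \<open>The core of the theorem at one regular point, with germs in place of functions.\<close>

lemma log_tower_not_in_field:
  fixes L :: "nat \<Rightarrow> complex poly poly" and f :: "nat \<Rightarrow> complex fps" and a :: "nat \<Rightarrow> complex"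
  assumes a: "inj_on a {..<Suc N}" "\<And>i. i < Suc N \<Longrightarrow> a i \<noteq> 0" "\<And>i. i < Suc N \<Longrightarrow> z \<noteq> a i" "z \<noteq> 0"
    and tower: "log_tower a z (Suc N) g = 1"
    and L: "\<And>i. i < k \<Longrightarrow> L i \<noteq> 0" "\<And>i. i < k \<Longrightarrow> card {x. poly (lead_coeff (L i)) x = 0} \<le> N"
      "\<And>i. i < k \<Longrightarrow> poly (lead_coeff (L i)) z \<noteq> 0" "\<And>i. i < k \<Longrightarrow> formal_solution z (L i) (f i)"
    and c: "\<And>\<alpha>. \<alpha> \<in> A \<Longrightarrow> algebraic_over (range (poly_germ z)) (c \<alpha>)"
    and d: "\<And>\<alpha>. \<alpha> \<in> B \<Longrightarrow> algebraic_over (range (poly_germ z)) (d \<alpha>)"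
    and nz: "(\<Sum>\<alpha>\<in>B. d \<alpha> * (\<Prod>i<k. f i ^ \<alpha> i)) \<noteq> 0"
    and eq: "g * (\<Sum>\<alpha>\<in>B. d \<alpha> * (\<Prod>i<k. f i ^ \<alpha> i)) = (\<Sum>\<alpha>\<in>A. c \<alpha> * (\<Prod>i<k. f i ^ \<alpha> i))"
  shows False
proof -
  define Z where "Z i = {x. poly (lead_coeff (L i)) x = 0}" for i
  have finZ: "finite (Z i)" if "i < k" for i
    unfolding Z_def using L(1)[OF that] by (intro poly_roots_finite) simp
  \<comment> \<open>The point 0 differs from every \<open>a i\<close>, so it keeps
    \<open>S - {a i}\<close> nonempty even if there is no other pole or zero.\<close>
  define S where "S = insert 0 (a ` {..<Suc N} \<union> (\<Union>i<k. Z i))"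
  have S: "finite S" "z \<notin> S" "\<And>i. i < Suc N \<Longrightarrow> a i \<in> S" "\<And>i. i < Suc N \<Longrightarrow> S - {a i} \<noteq> {}"
    using finZ a L(3) unfolding S_def by (auto simp: Z_def)
  have pos: "infdist z S' > 0" if "S' \<subseteq> S" "S' \<noteq> {}" for S'
  proof -
    have "closed S'" using S(1) that finite_subset by (blast intro: finite_imp_closed)
    then show ?thesis using S(2) that
      by (metis in_closed_iff_infdist_zero infdist_nonneg less_eq_real_def subsetD)
  qed
  obtain w \<kappa> where w: "continuation S z z w" "\<kappa> \<noteq> 0"
    "\<And>y c. continuable S z y \<Longrightarrow> log_tower a z (Suc N) y = fps_const c \<Longrightarrow> w y = y + fps_const (\<kappa> * c)"
    "\<And>j F. j \<le> N \<Longrightarrow> continuable (S - {a j}) z F \<Longrightarrow> w F = F"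
    using iterated_commutator_exists[OF S(1,2), of "Suc N" a N] S(3,4) a(1) by blast
  define E where "E = {F. continuable S z F \<and> w F = F}"
  have pE: "poly_germ z p \<in> E" for p
    unfolding E_def using continuation_poly_germ[OF w(1)] continuable_poly_germ by blast
  interpret fps_subring E
  proof
    show "1 \<in> E" using pE[of "[:1:]"] by (simp add: poly_germ_def)
    show "F + G \<in> E" "F * G \<in> E" if "F \<in> E" "G \<in> E" for F G
      using that w(1) by (auto simp: E_def continuable_add continuable_mult continuation_add continuation_mult)
    show "- F \<in> E" if "F \<in> E" for F
    proof -
      have "- F = fps_const (-1) * F" by (simp flip: fps_const_neg)
      then show ?thesis using that w(1)
        by (auto simp: E_def continuable_mult continuable_const continuation_mult continuation_const)
    qed
  qed
  have fE: "f i \<in> E" if i: "i < k" for i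
  proof -
    \<comment> \<open>Pigeonhole: at most \<open>N\<close> zeros cannot cover \<open>N + 1\<close>
      distinct poles. The missed pole may depend on \<open>i\<close>.\<close>
    have "\<not> a ` {..<Suc N} \<subseteq> Z i"
    proof
      assume "a ` {..<Suc N} \<subseteq> Z i"
      then have "card (a ` {..<Suc N}) \<le> card (Z i)" using finZ[OF i] by (rule card_mono[rotated])
      then show False using L(2)[OF i] a(1) by (simp add: card_image Z_def)
    qed
    then obtain j where j: "j < Suc N" "a j \<notin> Z i" unfolding image_subset_iff by auto
    have "continuable (S - {a j}) z (f i)"
    proof (rule formal_solution_continuable[OF L(4)[OF i] L(1)[OF i]])
      show "infdist z (S - {a j}) > 0" by (rule pos[OF Diff_subset S(4)[OF j(1)]])
      show "x \<in> S - {a j}" if "poly (lead_coeff (L i)) x = 0" for x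
        using that j(2) i by (auto simp: S_def Z_def)
    qed
    then show ?thesis
      unfolding E_def using w(4)[of j] j(1) continuable_mono[of "S - {a j}" z "f i" S] S(4)[OF j(1)] by auto
  qed
  have g: "continuable S z g"
    by (rule continuable_of_log_tower[of _ _ a "Suc N"])
       (use S(3) pos[of S] tower continuable_const[of S z 1] in \<open>auto simp: S_def\<close>)
  have wg: "w g = g + fps_const \<kappa>" using w(3)[OF g, of 1] tower by simp
  have germ_E: "algebraic_over E F" if "algebraic_over (range (poly_germ z)) F" for F
    using that pE unfolding algebraic_over_def by (metis rangeE)
  have expr: "algebraic_over E (\<Sum>\<alpha>\<in>I. e \<alpha> * (\<Prod>i<k. f i ^ \<alpha> i))"
    if "\<And>\<alpha>. \<alpha> \<in> I \<Longrightarrow> algebraic_over (range (poly_germ z)) (e \<alpha>)" for I e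
    by (intro algebraic_over_sum algebraic_over_mult algebraic_over_prod algebraic_over_power)
       (use germ_E that fE algebraic_over_self in auto)
  have "algebraic_over E g"
    by (rule algebraic_over_quotient[OF expr[of A c] expr[of B d] nz eq]) (use c d in auto)
  moreover have "\<not> algebraic_over E g"
  proof (rule not_algebraic_over_translates[OF _ w(2)])
    fix m n c assume c: "\<And>i. i \<le> n \<Longrightarrow> c i \<in> E" "(\<Sum>i\<le>n. c i * g ^ i) = 0"
    \<comment> \<open>Applying \<open>w\<close>, which fixes the coefficients, to the relation for
      one translate gives the relation for the next.\<close>
    show "(\<Sum>i\<le>n. c i * (g + fps_const (of_nat m * \<kappa>)) ^ i) = 0"
    proof (induction m)
      case (Suc m)
      let ?y = "g + fps_const (of_nat m * \<kappa>)"
      have y: "continuable S z ?y" by (intro continuable_add g continuable_const)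
      have "w ?y = g + fps_const (of_nat (Suc m) * \<kappa>)"
        unfolding continuation_add[OF w(1) g continuable_const] wg continuation_const[OF w(1)]
        by (simp add: algebra_simps flip: fps_const_add)
      moreover have "w (\<Sum>i\<le>n. c i * ?y ^ i) = (\<Sum>i\<le>n. w (c i * ?y ^ i))"
        using continuation_sum[OF w(1), of "{..n}" "\<lambda>i. c i * ?y ^ i"] c(1) continuation_power[OF w(1) y]
        by (auto simp: E_def intro: continuable_mult)
      moreover have "w (c i * ?y ^ i) = c i * w ?y ^ i" if "i \<le> n" for i
        using continuation_mult[OF w(1), of "c i" "?y ^ i"] continuation_power[OF w(1) y] c(1)[OF that]
        by (auto simp: E_def)
      ultimately show ?case using Suc continuation_const[OF w(1), of 0] by simp
    qed (use c in simp)
  qed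
  ultimately show False by blast
qed

section \<open>Germs of elements of K\<close>

text \<open>Identities of meromorphic functions are known only off a sparse set, perhaps not at
  \<open>z\<close>; Laurent expansions ignore the value there.\<close>

lemma fps_eqI_eventually_at:
  fixes F G :: "complex fps"
  assumes "(\<lambda>x. f (z + x)) has_fps_expansion F" "(\<lambda>x. g (z + x)) has_fps_expansion G"
    "eventually (\<lambda>x. f x = g x) (at z)"
  shows "F = G"
proof -
  have "(\<lambda>x. f (z + x)) has_laurent_expansion fps_to_fls F" "(\<lambda>x. g (z + x)) has_laurent_expansion fps_to_fls G"
    using assms(1,2) by (auto simp: has_fps_expansion_to_laurent)
  then have "fps_to_fls F = fps_to_fls G"
    using has_laurent_expansion_cong'[OF assms(3) refl refl, of "fps_to_fls F"] has_laurent_expansion_unique by blast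
  then show ?thesis by simp
qed

lemma has_fps_expansion_higher_deriv:
  assumes "(\<lambda>x. f (z + x)) has_fps_expansion (F :: complex fps)"
  shows "(\<lambda>x. (deriv ^^ i) f (z + x)) has_fps_expansion fps_nth_deriv i F"
proof (induction i)
  case (Suc i)
  have "deriv (\<lambda>x. (deriv ^^ i) f (z + x)) = (\<lambda>x. (deriv ^^ Suc i) f (z + x))"
  proof
    fix x
    show "deriv (\<lambda>x. (deriv ^^ i) f (z + x)) x = (deriv ^^ Suc i) f (z + x)"
      using deriv_shift_0[of "\<lambda>x. (deriv ^^ i) f (z + x)" x] deriv_shift_0[of "(deriv ^^ i) f" "z + x"]
      by (simp add: o_def add.assoc)
  qed
  then show ?case using has_fps_expansion_deriv[OF Suc] by (simp add: fps_nth_deriv_commute del: fps_nth_deriv.simps)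
qed (use assms in simp)

text \<open>Evaluating the coefficients may lower the degree. Summing up to the degree of
  \<open>P\<close> makes the relation uniform in the point of evaluation.\<close>

lemma poly_map_poly_eq_sum: "poly (map_poly h P) y = (\<Sum>i\<le>degree P. h (coeff P i) * y ^ i)" if "h 0 = 0" for h :: "complex poly \<Rightarrow> complex"
proof -
  have "poly (map_poly h P) y = (\<Sum>i\<le>degree (map_poly h P). h (coeff P i) * y ^ i)"
    using that by (simp add: poly_altdef coeff_map_poly)
  also have "\<dots> = (\<Sum>i\<le>degree P. h (coeff P i) * y ^ i)"
  proof (rule sum.mono_neutral_left)
    have "degree (map_poly h P) \<le> degree P"
      by (rule degree_le) (use that in \<open>auto simp: coeff_map_poly coeff_eq_0\<close>)
    then show "{..degree (map_poly h P)} \<subseteq> {..degree P}" by auto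
    have "h (coeff P i) = 0" if "degree (map_poly h P) < i" for i
      using coeff_eq_0[OF that] \<open>h 0 = 0\<close> by (simp add: coeff_map_poly)
    then show "\<forall>i\<in>{..degree P} - {..degree (map_poly h P)}. h (coeff P i) * y ^ i = 0" by auto
  qed simp
  finally show ?thesis .
qed

lemma algebraic_function_germ:
  assumes "P \<noteq> 0" "eventually (\<lambda>x. poly (map_poly (\<lambda>q. poly q x) P) (c x) = 0) (at z)"
    and "(\<lambda>x. c (z + x)) has_fps_expansion C"
  shows "algebraic_over (range (poly_germ z)) C"
proof -
  have "(\<Sum>i\<le>degree P. poly_germ z (coeff P i) * C ^ i) = 0"
  proof (rule fps_eqI_eventually_at[where z = z])
    show "(\<lambda>x. \<Sum>i\<le>degree P. poly (coeff P i) (z + x) * c (z + x) ^ i) has_fps_expansion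
        (\<Sum>i\<le>degree P. poly_germ z (coeff P i) * C ^ i)"
      by (intro has_fps_expansion_sum has_fps_expansion_mult has_fps_expansion_power poly_germ_has_fps_expansion assms)
    show "\<forall>\<^sub>F x in at z. (\<Sum>i\<le>degree P. poly (coeff P i) x * c x ^ i) = 0"
      using assms(2) by (simp add: poly_map_poly_eq_sum)
  qed simp
  moreover have "poly_germ z (coeff P (degree P)) \<noteq> 0" using assms(1) by simp
  ultimately show ?thesis
    unfolding algebraic_over_def
    by (intro exI[of _ "degree P"] exI[of _ "\<lambda>i. poly_germ z (coeff P i)"]) blast
qed

lemma formal_solution_germ:
  assumes "eventually (\<lambda>x. (\<Sum>i\<le>degree L. poly (coeff L i) x * (deriv ^^ i) f x) = 0) (at z)"
    and "(\<lambda>x. f (z + x)) has_fps_expansion F"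
  shows "formal_solution z L F"
  unfolding formal_solution_def
proof (rule fps_eqI_eventually_at[where z = z, OF _ _ assms(1)])
  show "(\<lambda>x. \<Sum>i\<le>degree L. poly (coeff L i) (z + x) * (deriv ^^ i) f (z + x)) has_fps_expansion
      (\<Sum>i\<le>degree L. poly_germ z (coeff L i) * fps_nth_deriv i F)"
    by (intro has_fps_expansion_sum has_fps_expansion_mult has_fps_expansion_higher_deriv
        poly_germ_has_fps_expansion assms)
qed simp

text \<open>The tower on functions has no centre, so its equation can be followed through a chain of
  domains.\<close>

primrec log_tower_fun :: "(nat \<Rightarrow> complex) \<Rightarrow> nat \<Rightarrow> (complex \<Rightarrow> complex) \<Rightarrow> complex \<Rightarrow> complex" where
  "log_tower_fun a 0 g = g"
| "log_tower_fun a (Suc i) g = (\<lambda>x. (x - a i) * deriv (log_tower_fun a i g) x)"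

lemma log_tower_fun_holomorphic: "open U \<Longrightarrow> g holomorphic_on U \<Longrightarrow> log_tower_fun a i g holomorphic_on U"
  by (induction i) (auto intro!: holomorphic_intros)

lemma deriv_cong_open: "open W \<Longrightarrow> (\<And>x. x \<in> W \<Longrightarrow> f x = g x) \<Longrightarrow> x \<in> W \<Longrightarrow> deriv f x = deriv g (x::complex)"
  by (intro deriv_cong_ev refl) (auto simp: eventually_nhds)

lemma log_tower_fun_cong:
  assumes "open W" "\<And>x. x \<in> W \<Longrightarrow> f x = g x"
  shows "x \<in> W \<Longrightarrow> log_tower_fun a i f x = log_tower_fun a i g x"
proof (induction i arbitrary: x)
  case (Suc i)
  then show ?case using deriv_cong_open[OF assms(1), of "log_tower_fun a i f" "log_tower_fun a i g"] by simp
qed (use assms in simp)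

lemma log_tower_fun_germ:
  assumes "(\<lambda>x. g (z + x)) has_fps_expansion G"
  shows "(\<lambda>x. log_tower_fun a i g (z + x)) has_fps_expansion log_tower a z i G"
proof (induction i)
  case (Suc i)
  have "(\<lambda>x. poly [:- a i, 1:] (z + x) * deriv (log_tower_fun a i g) (z + x)) has_fps_expansion
      poly_germ z [:- a i, 1:] * fps_deriv (log_tower a z i G)"
    using has_fps_expansion_higher_deriv[OF Suc, of 1]
    by (intro has_fps_expansion_mult poly_germ_has_fps_expansion) simp
  then show ?case by (simp add: algebra_simps)
qed (use assms in simp)

lemma fps_conv_radius_log_tower: "fps_conv_radius (log_tower a z i F) \<ge> fps_conv_radius F"
proof (induction i)
  case (Suc i)
  have "fps_conv_radius (log_tower a z (Suc i) F) \<ge> fps_conv_radius (log_tower a z i F)"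
    using fps_conv_radius_mult[of "poly_germ z [:- a i, 1:]" "fps_deriv (log_tower a z i F)"]
    by (simp add: fps_conv_radius_deriv_eq)
  then show ?case using Suc by order
qed simp

lemma log_tower_fun_eval_fps:
  "x \<in> eball 0 (fps_conv_radius F) \<Longrightarrow> log_tower_fun a i (eval_fps F) x = eval_fps (log_tower a 0 i F) x"
proof (induction i arbitrary: x)
  case (Suc i)
  have r: "ereal (norm x) < fps_conv_radius (log_tower a 0 i F)"
    using Suc.prems fps_conv_radius_log_tower[of F a 0 i] by (simp add: in_eball_iff order_less_le_trans)
  have "log_tower_fun a (Suc i) (eval_fps F) x = (x - a i) * deriv (eval_fps (log_tower a 0 i F)) x"
    using deriv_cong_open[of "eball 0 (fps_conv_radius F)", OF _ Suc.IH Suc.prems] by simp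
  also have "deriv (eval_fps (log_tower a 0 i F)) x = eval_fps (fps_deriv (log_tower a 0 i F)) x"
    using r by (simp add: eval_fps_deriv)
  also have "(x - a i) * \<dots> = eval_fps (log_tower a 0 (Suc i) F) x"
    using r by (simp add: eval_fps_mult fps_conv_radius_deriv_eq)
  finally show ?case .
qed simp

text \<open>The tower of a holomorphic function is holomorphic, so the identity theorem carries the
  equation from the overlap \<open>W\<close> to all of the next domain.\<close>

lemma analytic_continuation_log_tower:
  assumes "analytic_continuation F U g" "log_tower a 0 M F = 1"
  shows "open U \<and> connected U \<and> U \<noteq> {} \<and> g holomorphic_on U \<and> (\<forall>x\<in>U. log_tower_fun a M g x = 1)"
  using assms(1)
proof induction
  case (start U g)
  have "log_tower_fun a M g x = 1" if "x \<in> U" for x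
  proof -
    have "log_tower_fun a M g x = log_tower_fun a M (eval_fps F) x"
      using start that by (intro log_tower_fun_cong[of U]) auto
    also have "\<dots> = 1" using log_tower_fun_eval_fps[of x F a M] start(4) that by (auto simp: assms(2))
    finally show ?thesis .
  qed
  moreover have "eval_fps F holomorphic_on U"
    using start(4) by (intro holomorphic_intros) auto
  then have "g holomorphic_on U" using start(5) by (simp cong: holomorphic_cong)
  ultimately show ?case using start by blast
next
  case (step U g V h W)
  have hol: "log_tower_fun a M h holomorphic_on V" using step by (intro log_tower_fun_holomorphic)
  have "log_tower_fun a M h x = 1" if "x \<in> W" for x
    using log_tower_fun_cong[of W h g x a M] step that by auto
  then have "log_tower_fun a M h x = 1" if "x \<in> V" for x
    using analytic_continuation_open[of W V "log_tower_fun a M h" "\<lambda>_. 1" x] step that hol by auto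
  then show ?case using step by blast
qed

lemma log_tower_not_in_K:
  assumes a: "inj_on a {..<Suc N}" "\<And>i. i < Suc N \<Longrightarrow> a i \<noteq> 0"
    and tower: "log_tower a 0 (Suc N) F = 1"
  shows "\<not> belongs_to_K F N"
proof
  assume "belongs_to_K F N"
  then obtain U g where ac: "analytic_continuation F U g" and "g \<in> K_on N U" unfolding belongs_to_K_def by blast
  then obtain k f A c B d where
    f: "\<And>i. i < k \<Longrightarrow> \<exists>L. lin_diff_eq L \<and> card (singularities L) \<le> N \<and> solution_on U L (f i)"
    and A: "finite A" "\<And>\<alpha>. \<alpha> \<in> A \<Longrightarrow> algebraic_function_on U (c \<alpha>)"
    and B: "finite B" "\<And>\<alpha>. \<alpha> \<in> B \<Longrightarrow> algebraic_function_on U (d \<alpha>)"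
    and nz: "\<not> (\<forall>\<^sub>\<approx>x\<in>U. poly_expr k B d f x = 0)"
    and eq: "\<forall>\<^sub>\<approx>x\<in>U. g x = poly_expr k A c f x / poly_expr k B d f x"
    unfolding K_on_def by blast
  have U: "open U" "g holomorphic_on U" "\<And>x. x \<in> U \<Longrightarrow> log_tower_fun a (Suc N) g x = 1"
    using analytic_continuation_log_tower[OF ac tower] by auto
  obtain L where L: "\<And>i. i < k \<Longrightarrow> lin_diff_eq (L i)" "\<And>i. i < k \<Longrightarrow> card (singularities (L i)) \<le> N"
    "\<And>i. i < k \<Longrightarrow> solution_on U (L i) (f i)" using f by metis
  have L0: "L i \<noteq> 0" if "i < k" for i using L(1)[OF that] by (simp add: lin_diff_eq_def)
  have finZ: "finite {x. poly (lead_coeff (L i)) x = 0}" if "i < k" for i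
    using L0[OF that] by (intro poly_roots_finite) simp
  have cardZ: "card {x. poly (lead_coeff (L i)) x = 0} \<le> N" if i: "i < k" for i
  proof -
    have "card {x. poly (lead_coeff (L i)) x = 0} = card (Some ` {x. poly (lead_coeff (L i)) x = 0})"
      by (simp add: card_image)
    also have "\<dots> \<le> card (singularities (L i))"
      unfolding singularities_def using finZ[OF i] by (intro card_mono) auto
    also have "\<dots> \<le> N" by (rule L(2)[OF i])
    finally show ?thesis .
  qed
  define bad where "bad = insert 0 (a ` {..<Suc N} \<union> (\<Union>i<k. {x. poly (lead_coeff (L i)) x = 0}))"
  have "finite bad" unfolding bad_def using finZ by auto
  define good where "good x \<longleftrightarrow> x \<in> U \<and> x \<notin> bad \<and> (\<forall>i\<in>{..<k}. f i analytic_on {x}) \<and>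
    (\<forall>\<alpha>\<in>A. c \<alpha> analytic_on {x}) \<and> (\<forall>\<alpha>\<in>B. d \<alpha> analytic_on {x})" for x
  have good: "\<forall>\<^sub>\<approx>x\<in>U. good x"
    unfolding good_def
    by (intro eventually_conj eventually_ball_finite ballI finite_lessThan A(1) B(1)
        meromorphic_on_imp_analytic_cosparse eventually_in_cosparse[OF subset_refl U(1)]
        eventually_not_in_cosparse finite_imp_sparse \<open>finite bad\<close>)
      (use L(3) A(2) B(2) in \<open>auto simp: solution_on_def algebraic_function_on_def\<close>)
  \<comment> \<open>Good points fill \<open>U\<close> up to a sparse set, while the zeros of the
    denominator do not; hence some good point has a nonzero denominator.\<close>
  have "\<exists>\<^sub>F x in cosparse U. good x \<and> poly_expr k B d f x \<noteq> 0"
  proof (rule ccontr)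
    assume "\<not> (\<exists>\<^sub>F x in cosparse U. good x \<and> poly_expr k B d f x \<noteq> 0)"
    then have "\<forall>\<^sub>\<approx>x\<in>U. \<not> (good x \<and> poly_expr k B d f x \<noteq> 0)" by (simp only: not_frequently)
    with good have "\<forall>\<^sub>\<approx>x\<in>U. poly_expr k B d f x = 0" by eventually_elim simp
    with nz show False by contradiction
  qed
  then obtain z where z: "good z" "poly_expr k B d f z \<noteq> 0" using frequently_ex by blast
  have zU: "z \<in> U" using z(1) by (simp add: good_def)
  note at_z = eventually_cosparse_imp_eventually_at[where B = UNIV and x = z, OF _ zU]
  define f' where "f' i = fps_expansion (f i) z" for i
  define c' where "c' \<alpha> = fps_expansion (c \<alpha>) z" for \<alpha>
  define d' where "d' \<alpha> = fps_expansion (d \<alpha>) z" for \<alpha>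
  define g' where "g' = fps_expansion g z"
  have f': "(\<lambda>x. f i (z + x)) has_fps_expansion f' i" if "i < k" for i
    unfolding f'_def using z(1) that by (intro analytic_at_imp_has_fps_expansion) (auto simp: good_def)
  have c': "(\<lambda>x. c \<alpha> (z + x)) has_fps_expansion c' \<alpha>" if "\<alpha> \<in> A" for \<alpha>
    unfolding c'_def using z(1) that by (intro analytic_at_imp_has_fps_expansion) (auto simp: good_def)
  have d': "(\<lambda>x. d \<alpha> (z + x)) has_fps_expansion d' \<alpha>" if "\<alpha> \<in> B" for \<alpha>
    unfolding d'_def using z(1) that by (intro analytic_at_imp_has_fps_expansion) (auto simp: good_def)
  have g': "(\<lambda>x. g (z + x)) has_fps_expansion g'"
    unfolding g'_def using U(1,2) zU by (intro analytic_at_imp_has_fps_expansion) (auto simp: analytic_at)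
  have exprA: "(\<lambda>x. poly_expr k A c f (z + x)) has_fps_expansion (\<Sum>\<alpha>\<in>A. c' \<alpha> * (\<Prod>i<k. f' i ^ \<alpha> i))"
    unfolding poly_expr_def
    by (intro has_fps_expansion_sum has_fps_expansion_mult has_fps_expansion_prod has_fps_expansion_power c' f') auto
  have exprB: "(\<lambda>x. poly_expr k B d f (z + x)) has_fps_expansion (\<Sum>\<alpha>\<in>B. d' \<alpha> * (\<Prod>i<k. f' i ^ \<alpha> i))"
    unfolding poly_expr_def
    by (intro has_fps_expansion_sum has_fps_expansion_mult has_fps_expansion_prod has_fps_expansion_power d' f') auto
  have alg: "algebraic_over (range (poly_germ z)) C"
    if h: "algebraic_function_on U h" "(\<lambda>x. h (z + x)) has_fps_expansion C" for h C
  proof -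
    obtain P where "P \<noteq> 0" "\<forall>\<^sub>\<approx>x\<in>U. poly (map_poly (\<lambda>q. poly q x) P) (h x) = 0"
      using h(1) unfolding algebraic_function_on_def by blast
    then show ?thesis using h(2) by (intro algebraic_function_germ[of P h z C] at_z)
  qed
  have exprB0: "poly_expr k B d f z = fps_nth (\<Sum>\<alpha>\<in>B. d' \<alpha> * (\<Prod>i<k. f' i ^ \<alpha> i)) 0"
    using has_fps_expansion_imp_0_eq_fps_nth_0[OF exprB] by simp
  \<comment> \<open>Division by zero gives 0, so the quotient can be multiplied out only where the
    denominator is nonzero.\<close>
  have ev_nz: "eventually (\<lambda>x. poly_expr k B d f x \<noteq> 0) (at z)"
  proof -
    have "isCont (\<lambda>x. poly_expr k B d f (z + x)) 0" by (rule has_fps_expansion_imp_continuous[OF exprB])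
    then have "((\<lambda>x. poly_expr k B d f (z + x)) \<longlongrightarrow> poly_expr k B d f z) (at 0)" by (simp add: isCont_def)
    then have "(poly_expr k B d f \<longlongrightarrow> poly_expr k B d f z) (at z)"
      by (rule LIM_offset_zero_cancel)
    then show ?thesis using z(2) by (rule tendsto_imp_eventually_ne)
  qed
  show False
  proof (rule log_tower_not_in_field[where a = a and N = N and z = z and g = g' and L = L and f = f' and k = k
        and A = A and B = B and c = c' and d = d'])
    have "log_tower a z (Suc N) g' = 1"
    proof (rule fps_eqI_eventually_at[where z = z])
      show "(\<lambda>x. log_tower_fun a (Suc N) g (z + x)) has_fps_expansion log_tower a z (Suc N) g'"
        by (rule log_tower_fun_germ[OF g'])
      show "\<forall>\<^sub>F x in at z. log_tower_fun a (Suc N) g x = 1"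
        using eventually_at_in_open'[OF U(1) zU] by eventually_elim (rule U(3))
    qed simp
    then show "log_tower a z (Suc N) g' = 1" .
    show "formal_solution z (L i) (f' i)" if "i < k" for i
      using L(3)[OF that] unfolding solution_on_def by (intro formal_solution_germ[OF _ f'[OF that]] at_z) auto
    show "g' * (\<Sum>\<alpha>\<in>B. d' \<alpha> * (\<Prod>i<k. f' i ^ \<alpha> i)) = (\<Sum>\<alpha>\<in>A. c' \<alpha> * (\<Prod>i<k. f' i ^ \<alpha> i))"
    proof (rule fps_eqI_eventually_at[OF has_fps_expansion_mult[OF g' exprB] exprA])
      show "\<forall>\<^sub>F x in at z. g x * poly_expr k B d f x = poly_expr k A c f x"
        using at_z[OF eq] ev_nz by eventually_elim simp
    qed
    show "(\<Sum>\<alpha>\<in>B. d' \<alpha> * (\<Prod>i<k. f' i ^ \<alpha> i)) \<noteq> 0" using exprB0 z(2) by auto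
    show "algebraic_over (range (poly_germ z)) (c' \<alpha>)" if "\<alpha> \<in> A" for \<alpha>
      by (rule alg[OF A(2)[OF that] c'[OF that]])
    show "algebraic_over (range (poly_germ z)) (d' \<alpha>)" if "\<alpha> \<in> B" for \<alpha>
      by (rule alg[OF B(2)[OF that] d'[OF that]])
  qed (use a L0 cardZ z(1) in \<open>auto simp: good_def bad_def\<close>)
qed

section \<open>Common multiples and the G-function\<close>

text \<open>With q = p^k, i C(q,i) = q C(q-1,i-1). If \<open>p\<close> did not divide the binomial
  coefficient, q would divide \<open>i\<close>, which is smaller.\<close>

lemma prime_dvd_choose_prime_power:
  fixes p :: nat
  assumes "prime p" "0 < i" "i < p ^ k"
  shows "p dvd (p ^ k choose i)"
proof (rule ccontr)
  assume "\<not> p dvd (p ^ k choose i)"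
  then have "coprime (p ^ k) (p ^ k choose i)" using assms(1) by (simp add: prime_imp_coprime)
  moreover have "p ^ k dvd i * (p ^ k choose i)"
    using times_binomial_minus1_eq[OF assms(2), of "p ^ k"] by simp
  ultimately have "p ^ k dvd i" by (simp add: coprime_dvd_mult_left_iff)
  then show False using assms(2,3) by (auto dest: dvd_imp_le)
qed

text \<open>Vandermonde for the splitting of \<open>2 * h\<close> into \<open>p ^ k\<close> and the
  rest: the term \<open>i = 0\<close> vanishes because the rest is below \<open>h\<close>, and
  \<open>p\<close> divides all others.\<close>

lemma prime_dvd_central_binomial:
  fixes p :: nat
  assumes "prime p" "h < p ^ k" "p ^ k \<le> 2 * h"
  shows "p dvd (2 * h choose h)"
proof -
  have "(2 * h choose h) = (\<Sum>i\<le>h. (p ^ k choose i) * ((2 * h - p ^ k) choose (h - i)))"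
    using vandermonde[of "p ^ k" "2 * h - p ^ k" h] assms(3) by simp
  moreover have "p dvd (p ^ k choose i) * ((2 * h - p ^ k) choose (h - i))" if "i \<le> h" for i
  proof (cases "i = 0")
    case True
    have "2 * h - p ^ k < h" using assms by linarith
    then show ?thesis using True by (simp add: binomial_eq_0)
  next
    case False
    then show ?thesis using prime_dvd_choose_prime_power[OF assms(1), of i k] that assms(2) by simp
  qed
  ultimately show ?thesis by (auto intro!: dvd_sum simp del: binomial_eq_0_iff)
qed

text \<open>Compare prime by prime. If the exact power \<open>p ^ k\<close> in \<open>m\<close> is
  at most \<open>h\<close>, it divides \<open>e\<close>; otherwise \<open>p ^ (k - 1)\<close> does,
  and the binomial coefficient supplies the missing \<open>p\<close>.\<close>

lemma dvd_mult_central_binomial: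
  assumes e: "\<And>m. 1 \<le> m \<Longrightarrow> m \<le> h \<Longrightarrow> m dvd e" and "e > 0" and m: "1 \<le> m" "m \<le> 2 * h"
  shows "m dvd e * (2 * h choose h)"
proof (rule multiplicity_le_imp_dvd)
  show "m \<noteq> 0" using m by simp
  fix p :: nat assume p: "prime p"
  define k where "k = multiplicity p m"
  have "p ^ k dvd m" unfolding k_def by (rule multiplicity_dvd)
  then have le: "p ^ k \<le> 2 * h" using m by (auto dest: dvd_imp_le)
  have "p ^ k dvd e * (2 * h choose h)"
  proof (cases "p ^ k \<le> h")
    case True
    then show ?thesis using e[of "p ^ k"] p prime_gt_0_nat[OF p] by (simp add: Suc_leI)
  next
    case False
    then obtain l where l: "k = Suc l" using le m by (cases k) auto
    have "2 * p ^ l \<le> p ^ k" using prime_ge_2_nat[OF p] l by simp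
    then have "p ^ l dvd e" using le p prime_gt_0_nat[OF p] by (intro e) (auto simp: Suc_leI)
    moreover have "p dvd (2 * h choose h)" using prime_dvd_central_binomial[OF p _ le] False by simp
    ultimately show ?thesis unfolding l by (simp add: mult_dvd_mono mult.commute[of p])
  qed
  moreover have "e * (2 * h choose h) \<noteq> 0" using \<open>e > 0\<close> by simp
  ultimately show "multiplicity p m \<le> multiplicity p (e * (2 * h choose h))"
    using p unfolding k_def[symmetric] by (intro multiplicity_geI) auto
qed

text \<open>Recursion to \<open>h = n div 2\<close>: multiply by the central binomial coefficient,
  and by \<open>n\<close> to cover odd \<open>n = 2 * h + 1\<close>. The base 16 solves c^h 4^h 4^h
  = c^(2h).\<close>

lemma common_multiple_bound: "\<exists>e>0. e \<le> 16 ^ n \<and> (\<forall>m. 1 \<le> m \<longrightarrow> m \<le> n \<longrightarrow> m dvd (e :: nat))"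
proof (induction n rule: less_induct)
  case (less n)
  show ?case
  proof (cases "n = 0")
    case False
    define h where "h = n div 2"
    have "h < n" using False by (simp add: h_def)
    then obtain e where e: "e > 0" "e \<le> 16 ^ h" "\<And>m. 1 \<le> m \<Longrightarrow> m \<le> h \<Longrightarrow> m dvd e" using less by blast
    have C: "(2 * h choose h) \<le> 4 ^ h"
    proof -
      have "(2 * h choose h) \<le> (\<Sum>k\<le>2 * h. 2 * h choose k)" by (rule member_le_sum) auto
      also have "\<dots> = 4 ^ h" by (simp add: choose_row_sum power_mult)
      finally show ?thesis .
    qed
    have nh: "n \<le> 2 * h + 1" "2 * h \<le> n" by (auto simp: h_def)
    show ?thesis
    proof (intro exI conjI allI impI)
      show "0 < e * (2 * h choose h) * n" using e False by simp
      have "n \<le> 4 ^ h"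
      proof (cases "h = 0")
        case True
        then show ?thesis using nh False by simp
      next
        case h: False
        have four: "2 * x + 1 \<le> 4 ^ x" if "x \<ge> 1" for x :: nat
          using that by (induction x rule: dec_induct) auto
        show ?thesis by (rule order_trans[OF nh(1) four]) (use h in simp)
      qed
      then have "e * (2 * h choose h) * n \<le> 16 ^ h * 4 ^ h * 4 ^ h" by (intro mult_mono e(2) C) auto
      also have "\<dots> = (16::nat) ^ (2 * h)" by (simp add: power_mult flip: power_mult_distrib)
      also have "\<dots> \<le> 16 ^ n" using nh by (intro power_increasing) auto
      finally show "e * (2 * h choose h) * n \<le> 16 ^ n" .
      show "m dvd e * (2 * h choose h) * n" if "1 \<le> m" "m \<le> n" for m
      proof (cases "m \<le> 2 * h")
        case True
        then show ?thesis using dvd_mult_central_binomial[OF e(3,1) that(1)] by (simp add: dvd_mult2)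
      next
        case False
        then have "m = n" using nh that by linarith
        then show ?thesis by simp
      qed
    qed
  qed (auto intro: exI[of _ 1])
qed

text \<open>With J = \<open>Suc j\<close>, integrating \<open>iterated_log j\<close> against dx/(x -
  1/J), where 1/(x - 1/J) is minus the sum of J^(k+1) x^k, gives these coefficients. At
  \<open>n = 0\<close> the sum is empty: the integration constant is 0.\<close>

primrec iterated_log :: "nat \<Rightarrow> complex fps" where
  "iterated_log 0 = 1"
| "iterated_log (Suc j) =
     Abs_fps (\<lambda>n. - (\<Sum>m<n. of_nat (Suc j) ^ (n - m) * fps_nth (iterated_log j) m) / of_nat n)"

lemma iterated_log_deriv:
  "fps_of_poly [:- (1 / of_nat (Suc j)), 1:] * fps_deriv (iterated_log (Suc j)) = iterated_log j"
proof (rule fps_ext)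
  fix n
  define J where "J = (of_nat (Suc j) :: complex)"
  have J: "J \<noteq> 0" by (simp add: J_def del: of_nat_Suc)
  define F where "F = iterated_log j"
  have d: "fps_nth (fps_deriv (iterated_log (Suc j))) n = - (\<Sum>m\<le>n. J ^ (Suc n - m) * fps_nth F m)" for n
    by (simp add: J_def F_def lessThan_Suc_atMost del: of_nat_Suc)
  have p: "fps_of_poly [:- (1 / J), 1:] = fps_X - fps_const (1 / J)"
    by (simp add: fps_of_poly_pCons flip: fps_const_neg)
  have e: "(\<Sum>m\<le>n. J ^ (Suc n - m) * fps_nth F m) / J = (\<Sum>m\<le>n. J ^ (n - m) * fps_nth F m)"
    using J by (simp add: sum_divide_distrib Suc_diff_le)
  have "fps_nth (fps_of_poly [:- (1 / J), 1:] * fps_deriv (iterated_log (Suc j))) n = fps_nth F n"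
  proof (cases n)
    case 0
    then show ?thesis using J unfolding p by (simp add: algebra_simps d del: iterated_log.simps fps_deriv_nth)
  next
    case (Suc k)
    then show ?thesis using J e unfolding p
      by (simp add: left_diff_distrib diff_divide_distrib d del: iterated_log.simps fps_deriv_nth)
  qed
  then show "fps_nth (fps_of_poly [:- (1 / of_nat (Suc j)), 1:] * fps_deriv (iterated_log (Suc j))) n = fps_nth (iterated_log j) n"
    by (simp only: J_def F_def)
qed

text \<open>The outermost integration of \<open>iterated_log M\<close> has the pole 1/M, so the
  poles are listed with decreasing denominators.\<close>

lemma log_tower_iterated_log:
  "i \<le> M \<Longrightarrow> log_tower (\<lambda>i. 1 / of_nat (M - i)) 0 i (iterated_log M) = iterated_log (M - i)"
proof (induction i)
  case (Suc i)
  then have "M - i = Suc (M - Suc i)" by simp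
  then show ?case using Suc iterated_log_deriv[of "M - Suc i"]
    by (simp add: poly_germ_def del: iterated_log.simps)
qed simp

section \<open>Arithmetic of the coefficients\<close>

lemma iterated_log_rational: "fps_nth (iterated_log j) n \<in> \<rat>"
  by (induction j arbitrary: n) (auto intro!: Rats_divide Rats_sum Rats_mult Rats_power Rats_add simp flip: of_nat_Suc)

text \<open>The division by \<open>n\<close> turns the sum of \<open>n\<close> terms into an
  average, so each layer only raises the base of the power.\<close>

lemma norm_iterated_log_le: "norm (fps_nth (iterated_log j) n) \<le> real (Suc j) ^ (n + 1)"
proof (induction j arbitrary: n)
  case (Suc j)
  let ?J = "real (Suc j)"
  show ?case
  proof (cases "n = 0")
    case False
    have "norm (fps_nth (iterated_log (Suc j)) n) = norm (\<Sum>m<n. of_nat (Suc j) ^ (n - m) * fps_nth (iterated_log j) m) / real n"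
      by (simp add: norm_divide)
    also have "\<dots> \<le> (\<Sum>m<n. ?J ^ (n + 1)) / real n"
    proof (intro divide_right_mono sum_norm_le)
      fix m assume m: "m \<in> {..<n}"
      have "norm (of_nat (Suc j) ^ (n - m) * fps_nth (iterated_log j) m) \<le> ?J ^ (n - m) * ?J ^ (m + 1)"
        unfolding norm_mult norm_power norm_of_nat by (intro mult_left_mono Suc.IH) auto
      also have "\<dots> = ?J ^ (n + 1)" using m by (simp only: power_add[symmetric]) simp
      finally show "norm (of_nat (Suc j) ^ (n - m) * fps_nth (iterated_log j) m) \<le> ?J ^ (n + 1)" .
    qed simp
    also have "\<dots> = ?J ^ (n + 1)" using False by simp
    also have "\<dots> \<le> real (Suc (Suc j)) ^ (n + 1)" by (intro power_mono) auto
    finally show ?thesis .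
  qed simp
qed (simp add: fps_one_nth)

text \<open>Each layer divides by one index \<open>m \<le> n\<close>, which one factor
  \<open>e\<close> absorbs; \<open>e ^ j\<close> clears all coefficients of the layer below at
  once.\<close>

lemma iterated_log_denominator:
  assumes e: "\<And>m. 1 \<le> m \<Longrightarrow> m \<le> n \<Longrightarrow> m dvd (e :: nat)"
  shows "m \<le> n \<Longrightarrow> of_nat (e ^ j) * fps_nth (iterated_log j) m \<in> \<int>"
proof (induction j arbitrary: m)
  case (Suc j)
  show ?case
  proof (cases "m = 0")
    case False
    then obtain q where q: "e = m * q" using e[of m] Suc.prems by auto
    define R where "R = (\<Sum>l<m. of_nat (Suc j) ^ (m - l) * fps_nth (iterated_log j) l)"
    have "of_nat (e ^ Suc j) = (of_nat m * of_nat q * of_nat (e ^ j) :: complex)" by (simp add: q)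
    moreover have "fps_nth (iterated_log (Suc j)) m = - R / of_nat m" by (simp add: R_def)
    ultimately have "of_nat (e ^ Suc j) * fps_nth (iterated_log (Suc j)) m = - (of_nat q * (of_nat (e ^ j) * R))"
      using False by (simp only:) simp
    also have "of_nat (e ^ j) * R = (\<Sum>l<m. of_nat (Suc j) ^ (m - l) * (of_nat (e ^ j) * fps_nth (iterated_log j) l))"
      unfolding R_def sum_distrib_left by (intro sum.cong refl) (simp only: mult_ac)
    also have "- (of_nat q * \<dots>) \<in> \<int>"
      using Suc.prems by (intro Ints_minus Ints_mult Ints_sum Ints_power Ints_of_nat Suc.IH) auto
    finally show ?thesis .
  qed simp
qed (simp add: fps_one_nth)

text \<open>Insert F = (x - b) G' into the equation of the layer below; by Leibniz F^(i) = (x - b)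
  G^(i+1) + i G^(i), so the order rises by one.\<close>

lemma iterated_log_ode:
  "\<exists>p c. (\<forall>i k. coeff (c i) k \<in> \<rat>) \<and> c p \<noteq> 0 \<and>
     (\<Sum>i\<le>p. fps_of_poly (c i) * fps_nth_deriv i (iterated_log j)) = 0"
proof (induction j)
  case 0
  show ?case
    by (intro exI[of _ 1] exI[of _ "\<lambda>i. if i = 1 then 1 else 0"]) (auto simp: one_pCons coeff_pCons split: nat.splits)
next
  case (Suc j)
  then obtain p c where c: "\<And>i k. coeff (c i) k \<in> \<rat>" "c p \<noteq> 0"
    "(\<Sum>i\<le>p. fps_of_poly (c i) * fps_nth_deriv i (iterated_log j)) = 0" by blast
  define b where "b = (1 / of_nat (Suc j) :: complex)"
  have b: "b \<in> \<rat>" unfolding b_def by (intro Rats_divide Rats_1 Rats_of_nat)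
  define G where "G = iterated_log (Suc j)"
  have FG: "fps_nth_deriv i (iterated_log j) =
      fps_of_poly [:- b, 1:] * fps_nth_deriv (Suc i) G + of_nat i * fps_nth_deriv i G" for i
  proof (induction i)
    case 0
    show ?case using iterated_log_deriv[of j] by (simp add: b_def G_def del: iterated_log.simps)
  next
    case (Suc i)
    have "fps_deriv (fps_of_poly [:- b, 1:]) = 1" by (simp add: fps_of_poly_pCons)
    then show ?case
      unfolding fps_nth_deriv_commute[of i "iterated_log j"] Suc
      by (simp add: fps_nth_deriv_commute algebra_simps del: fps_nth_deriv.simps)
  qed
  \<comment> \<open>Coefficient of the \<open>i\<close>-th derivative of \<open>G\<close>, collected
    from the derivatives \<open>i - 1\<close> and \<open>i\<close> of the layer below. At
    \<open>i = Suc p\<close> only the first summand survives, which is nonzero.\<close>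
  define c' where "c' i = (if i = 0 then 0 else [:- b, 1:] * c (i - 1)) + (if i \<le> p then smult (of_nat i) (c i) else 0)" for i
  show ?case
  proof (intro exI conjI allI)
    show "coeff (c' i) k \<in> \<rat>" for i k
      unfolding c'_def using c(1) b
      by (auto simp: coeff_pCons split: nat.splits intro!: Rats_add Rats_mult Rats_diff)
    show "c' (Suc p) \<noteq> 0" using c(2) by (simp add: c'_def del: mult_pCons_left)
    have "(\<Sum>i\<le>Suc p. fps_of_poly (c' i) * fps_nth_deriv i G) =
        (\<Sum>i\<le>Suc p. fps_of_poly (if i = 0 then 0 else [:- b, 1:] * c (i - 1)) * fps_nth_deriv i G) +
        (\<Sum>i\<le>Suc p. fps_of_poly (if i \<le> p then smult (of_nat i) (c i) else 0) * fps_nth_deriv i G)"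
      by (simp only: c'_def fps_of_poly_add distrib_right sum.distrib)
    also have "(\<Sum>i\<le>Suc p. fps_of_poly (if i = 0 then 0 else [:- b, 1:] * c (i - 1)) * fps_nth_deriv i G) =
        (\<Sum>i\<le>p. fps_of_poly [:- b, 1:] * fps_of_poly (c i) * fps_nth_deriv (Suc i) G)"
      by (subst sum.atMost_Suc_shift) (simp add: fps_of_poly_mult del: fps_nth_deriv.simps mult_pCons_left)
    also have "(\<Sum>i\<le>Suc p. fps_of_poly (if i \<le> p then smult (of_nat i) (c i) else 0) * fps_nth_deriv i G) =
        (\<Sum>i\<le>p. of_nat i * fps_of_poly (c i) * fps_nth_deriv i G)"
      by (simp add: fps_of_poly_smult fps_of_nat)
    also have "(\<Sum>i\<le>p. fps_of_poly [:- b, 1:] * fps_of_poly (c i) * fps_nth_deriv (Suc i) G) +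
        (\<Sum>i\<le>p. of_nat i * fps_of_poly (c i) * fps_nth_deriv i G) =
        (\<Sum>i\<le>p. fps_of_poly (c i) * fps_nth_deriv i (iterated_log j))"
      unfolding FG sum.distrib[symmetric] by (intro sum.cong refl) (simp add: algebra_simps del: fps_nth_deriv.simps)
    finally show "(\<Sum>i\<le>Suc p. fps_of_poly (c' i) * fps_nth_deriv i (iterated_log (Suc j))) = 0"
      using c(3) by (simp only: G_def)
  qed
qed

lemma iterated_log_G_function: "G_function (iterated_log M)"
  unfolding G_function_def
proof (intro conjI)
  show "\<forall>n. algebraic (fps_nth (iterated_log M) n)"
    using iterated_log_rational rat_imp_algebraic by blast
  obtain p c where c: "\<And>i k. coeff (c i) k \<in> \<rat>" "c p \<noteq> 0"
    "(\<Sum>i\<le>p. fps_of_poly (c i) * fps_nth_deriv i (iterated_log M)) = 0" using iterated_log_ode[of M] by blast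
  show "\<exists>p c. (\<forall>i\<le>p. c i \<in> Qbar_ratfuns) \<and> (\<exists>i\<le>p. c i \<noteq> 0) \<and>
      (\<Sum>i\<le>p. c i * fps_to_fls (fps_nth_deriv i (iterated_log M))) = 0"
  proof (intro exI conjI allI impI)
    show "fps_to_fls (fps_of_poly (c i)) \<in> Qbar_ratfuns" for i
    proof -
      have "fps_to_fls (fps_of_poly (c i)) = fps_to_fls (fps_of_poly (c i)) / fps_to_fls (fps_of_poly 1)" by simp
      moreover have "algebraic (coeff 1 k :: complex)" for k
        by (intro rat_imp_algebraic) (auto simp: one_pCons coeff_pCons split: nat.splits)
      moreover have "algebraic (coeff (c i) k)" for k by (rule rat_imp_algebraic[OF c(1)])
      ultimately show ?thesis unfolding Qbar_ratfuns_def
        by (intro CollectI exI[of _ "c i"] exI[of _ 1] conjI allI) auto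
    qed
    show "p \<le> p" "fps_to_fls (fps_of_poly (c p)) \<noteq> 0" using c(2) by simp_all
    have "(\<Sum>i\<le>p. fps_to_fls (fps_of_poly (c i)) * fps_to_fls (fps_nth_deriv i (iterated_log M))) =
        fps_to_fls (\<Sum>i\<le>p. fps_of_poly (c i) * fps_nth_deriv i (iterated_log M))"
      by (simp only: fps_to_fls_sum fls_times_fps_to_fls)
    then show "(\<Sum>i\<le>p. fps_to_fls (fps_of_poly (c i)) * fps_to_fls (fps_nth_deriv i (iterated_log M))) = 0"
      using c(3) by simp
  qed
  \<comment> \<open>The coefficients are rational, so all conjugates coincide and the bound on
    absolute values suffices.\<close>
  have fixed: "\<sigma> (fps_nth (iterated_log M) n) = fps_nth (iterated_log M) n" if "\<sigma> \<in> galois_Qbar" for \<sigma> n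
    using that iterated_log_rational unfolding galois_Qbar_def by blast
  show "\<exists>C>0::real. \<forall>\<sigma>\<in>galois_Qbar. \<forall>n. norm (\<sigma> (fps_nth (iterated_log M) n)) \<le> C ^ (n + 1)"
  proof (intro exI conjI ballI allI)
    show "0 < real (Suc M)" by simp
    show "norm (\<sigma> (fps_nth (iterated_log M) n)) \<le> real (Suc M) ^ (n + 1)" if "\<sigma> \<in> galois_Qbar" for \<sigma> n
      unfolding fixed[OF that] by (rule norm_iterated_log_le)
  qed
  obtain e where e: "\<And>n. 0 < e n" "\<And>n. e n \<le> (16::nat) ^ n" "\<And>n m. 1 \<le> m \<Longrightarrow> m \<le> n \<Longrightarrow> m dvd e n"
    using common_multiple_bound by metis
  show "\<exists>D>0::real. \<exists>d :: nat \<Rightarrow> int. \<forall>n. 1 \<le> d n \<and> real_of_int (d n) \<le> D ^ (n + 1) \<and>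
        (\<forall>m\<le>n. algebraic_int (of_int (d n) * fps_nth (iterated_log M) m))"
  proof (intro exI conjI allI impI)
    show "(0::real) < 16 ^ M" by simp
    fix n
    show "1 \<le> int (e n ^ M)" using e(1)[of n] by (simp add: Suc_leI flip: of_nat_power)
    have "real (e n ^ M) \<le> (16 ^ n) ^ M"
      using e(2)[of n] by (metis of_nat_le_iff of_nat_numeral of_nat_power power_mono zero_le)
    also have "\<dots> = (16 ^ M) ^ n" by (simp add: mult.commute flip: power_mult)
    also have "\<dots> \<le> (16 ^ M) ^ (n + 1)" by (intro power_increasing) auto
    finally show "real_of_int (int (e n ^ M)) \<le> (16 ^ M) ^ (n + 1)" by simp
    fix m assume "m \<le> n"
    then have "of_nat (e n ^ M) * fps_nth (iterated_log M) m \<in> \<int>" by (intro iterated_log_denominator e(3))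
    then show "algebraic_int (of_int (int (e n ^ M)) * fps_nth (iterated_log M) m)"
      by (intro int_imp_algebraic_int) simp
  qed
qed

theorem theorem1:
  fixes N :: nat
  shows "\<exists>\<xi> :: complex fps. G_function \<xi> \<and> \<not> belongs_to_K \<xi> N"
proof (intro exI conjI)
  show "G_function (iterated_log (Suc N))" by (rule iterated_log_G_function)
  show "\<not> belongs_to_K (iterated_log (Suc N)) N"
  proof (rule log_tower_not_in_K)
    show "inj_on (\<lambda>i. 1 / of_nat (Suc N - i) :: complex) {..<Suc N}"
    proof (rule inj_onI)
      fix i j assume ij: "i \<in> {..<Suc N}" "j \<in> {..<Suc N}"
        "1 / of_nat (Suc N - i) = (1 / of_nat (Suc N - j) :: complex)"
      then have "Suc N - i = Suc N - j"
        by (simp only: inverse_eq_divide[symmetric] inverse_eq_iff_eq of_nat_eq_iff)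
      then show "i = j" using ij(1,2) by auto
    qed
    show "1 / of_nat (Suc N - i) \<noteq> (0 :: complex)" if "i < Suc N" for i
    proof -
      have "Suc N - i \<noteq> 0" using that by simp
      then show ?thesis by (simp only: divide_eq_0_iff of_nat_eq_0_iff one_neq_zero simp_thms)
    qed
    show "log_tower (\<lambda>i. 1 / of_nat (Suc N - i)) 0 (Suc N) (iterated_log (Suc N)) = 1"
      using log_tower_iterated_log[of "Suc N" "Suc N"] by simp
  qed
qed

end
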